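(* Assume the Continuum Hypothesis ($2^{\aleph_0}=\aleph_1$). Then there exists a locally connected continuum without nontrivial convergent sequences.
   Context: A continuum is a compact connected Hausdorff space (not assumed metrizable). A nontrivial convergent sequence in a space $X$ is a sequence $(x_n)_{n\in\mathbb{N}}$ of pairwise distinct points of $X$ that converges to some point of $X$. *)

theory Defs
  imports "HOL-Analysis.Analysis"
begin

unbundle cardinal_syntax

text \<open>Two to the power aleph-zero equals aleph-one; here \<open>cardSuc natLeq\<close> is the least
  cardinal above aleph-zero.\<close>

definition Continuum_Hypothesis :: bool where
  "Continuum_Hypothesis \<longleftrightarrow> ctwo ^c natLeq =o cardSuc natLeq"

definition continuum_space :: "'a topology \<Rightarrow> bool" where
  "continuum_space X \<longleftrightarrow> compact_space X \<and> connected_space X \<and> Hausdorff_space X"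

text \<open>The empty space and the one-point spaces satisfy \<^const>\<open>continuum_space\<close>; nondegeneracy
  is required separately. A connected Hausdorff space with two points is infinite.\<close>

definition nondegenerate_space :: "'a topology \<Rightarrow> bool" where
  "nondegenerate_space X \<longleftrightarrow> (\<exists>x \<in> topspace X. \<exists>y \<in> topspace X. x \<noteq> y)"

definition nontrivial_convergent_sequence :: "'a topology \<Rightarrow> (nat \<Rightarrow> 'a) \<Rightarrow> bool" where
  "nontrivial_convergent_sequence X x \<longleftrightarrow>
     inj x \<and> range x \<subseteq> topspace X \<and> (\<exists>l. limitin X x l sequentially)"

text \<open>HOL cannot quantify existentially over types, so existence of a space is asserted for an
  arbitrary topology with points in \<open>real \<Rightarrow> real\<close> (not the product topology). Every compact
  Hausdorff space of weight at most the cardinality of the reals embeds in a power of the unit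
  interval indexed by the reals, hence is homeomorphic to such a topology.\<close>

end

theory Submission
  imports Defs
begin

text \<open>
  The space is a closed subset of a cube. One kind of coordinate is free. Every sequence \<open>T\<close> of
  triples (coordinate \<open>d\<^sub>n\<close>, real \<open>x\<^sub>n\<close>, gate \<open>g\<^sub>n\<close>) contributes one further coordinate, whose value
  at a point \<open>y\<close> with \<open>y(d\<^sub>n) \<noteq> x\<^sub>n\<close> for some \<open>n\<close> is a weighted mean of the numbers \<open>g\<^sub>n(y(c\<^sub>n))\<close>,
  where \<open>c\<^sub>n\<close> is the free coordinate named by the first \<open>n\<close> triples; the nearer the \<open>y(d\<^sub>i)\<close> are to the
  \<open>x\<^sub>i\<close>, the later the indices \<open>n\<close> that carry weight. If \<open>y(d\<^sub>n) = x\<^sub>n\<close> for all \<open>n\<close> the value is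
  unconstrained: the point is blown up to an interval.

  If \<open>y\<^sub>k\<close> converged to \<open>l\<close> with \<open>y\<^sub>k \<noteq> l\<close>, choose \<open>d\<^sub>k\<close> with \<open>y\<^sub>k(d\<^sub>k) \<noteq> l(d\<^sub>k)\<close> and \<open>x = l \<circ> d\<close>. On a
  subsequence the \<open>y\<^sub>k\<close> put their weight on disjoint blocks of indices, and suitable gates make
  the new coordinate alternate between 0 and 1.

  Coordinates depend on one another in a well-founded way, and a solution set in which each
  coordinate ranges over an interval determined by its predecessors is connected. A small box
  around a point is such a set: two different sequences \<open>T\<close> share only finitely many free
  coordinates, so restricting finitely many blown-up coordinates to intervals amounts to
  restricting far free coordinates to intervals, one at a time.
\<close>

section \<open>Well-founded systems of interval constraints\<close>

text \<open>Well-founded recursion that copies \<open>a\<close> on the down-closed set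
  \<open>S\<close> and picks some element of \<open>\<Phi> i\<close> elsewhere; by
  \<open>dep\<close> the choice at \<open>i\<close> reads only values already fixed.\<close>

lemma constraint_system_extend:
  fixes \<Phi> :: "'i \<Rightarrow> ('i \<Rightarrow> 'a) \<Rightarrow> 'a set"
  assumes wf: "wf r"
    and dep: "\<And>i y y'. (\<And>j. (j, i) \<in> r \<Longrightarrow> y j = y' j) \<Longrightarrow> \<Phi> i y = \<Phi> i y'"
    and ne: "\<And>i y. \<Phi> i y \<noteq> {}"
    and down: "\<And>i j. i \<in> S \<Longrightarrow> (j, i) \<in> r \<Longrightarrow> j \<in> S"
    and sat: "\<And>i. i \<in> S \<Longrightarrow> a i \<in> \<Phi> i a"
  obtains z where "\<And>i. i \<in> S \<Longrightarrow> z i = a i" "\<And>i. z i \<in> \<Phi> i z"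
proof -
  define H where "H = (\<lambda>f i. if i \<in> S then a i else (SOME t. t \<in> \<Phi> i f))"
  define z where "z = wfrec r H"
  have z: "z i = H (cut z r i) i" for i
    unfolding z_def by (rule wfrec[OF wf])
  have inS: "z i = a i" if "i \<in> S" for i
    using z[of i] that by (simp add: H_def)
  have "z i \<in> \<Phi> i z" for i
  proof (cases "i \<in> S")
    case True
    have "\<Phi> i z = \<Phi> i a"
      by (rule dep) (use inS down True in blast)
    then show ?thesis using sat[OF True] inS[OF True] by simp
  next
    case False
    have "\<Phi> i (cut z r i) = \<Phi> i z"
      by (rule dep) (simp add: cut_apply)
    then have "z i = (SOME t. t \<in> \<Phi> i z)" using z[of i] False by (simp add: H_def)
    then show ?thesis using ne[of i z] by (simp add: some_in_eq)
  qed
  then show thesis using that inS by blast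
qed

text \<open>If the solution set split into clopen pieces \<open>A\<close> and \<open>B\<close>, take a maximal down-closed set
  of coordinates on which some point of \<open>A\<close> agrees with some point of \<open>B\<close>. A minimal missing
  coordinate ranges over a connected set covered by its values on \<open>A\<close> and on \<open>B\<close>, so the
  agreement could be extended.\<close>

lemma constraint_system_connected:
  fixes \<Phi> :: "'i \<Rightarrow> ('i \<Rightarrow> 'a::t2_space) \<Rightarrow> 'a set"
  assumes wf: "wf r"
    and dep: "\<And>i y y'. (\<And>j. (j, i) \<in> r \<Longrightarrow> y j = y' j) \<Longrightarrow> \<Phi> i y = \<Phi> i y'"
    and ne: "\<And>i y. \<Phi> i y \<noteq> {}"
    and conn: "\<And>i y. connected (\<Phi> i y)"
    and comp: "compact {y. \<forall>i. y i \<in> \<Phi> i y}"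
  shows "connected {y. \<forall>i. y i \<in> \<Phi> i y}"
proof (rule ccontr)
  let ?E = "{y. \<forall>i. y i \<in> \<Phi> i y}"
  assume "\<not> connected ?E"
  then obtain A0 B0 where cl: "closed A0" "closed B0" and cov: "?E \<subseteq> A0 \<union> B0"
    and disj: "A0 \<inter> B0 \<inter> ?E = {}" and neA: "A0 \<inter> ?E \<noteq> {}" and neB: "B0 \<inter> ?E \<noteq> {}"
    unfolding connected_closed by blast
  define A where "A = ?E \<inter> A0"
  define B where "B = ?E \<inter> B0"
  have AB: "compact A" "compact B" "A \<inter> B = {}" "A \<noteq> {}" "B \<noteq> {}" "?E = A \<union> B"
    using comp cl cov disj neA neB unfolding A_def B_def by (auto intro: compact_Int_closed)
  define agree where "agree S = {ab \<in> A \<times> B. \<forall>i\<in>S. fst ab i = snd ab i}" for S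
  define \<S> where "\<S> = {S. (\<forall>i j. i \<in> S \<longrightarrow> (j, i) \<in> r \<longrightarrow> j \<in> S) \<and> agree S \<noteq> {}}"
  have coordf: "continuous_on UNIV (\<lambda>ab :: ('i \<Rightarrow> 'a) \<times> ('i \<Rightarrow> 'a). fst ab i)"
    and coords: "continuous_on UNIV (\<lambda>ab :: ('i \<Rightarrow> 'a) \<times> ('i \<Rightarrow> 'a). snd ab i)" for i
    by (rule continuous_on_product_then_coordinatewise,
        intro continuous_on_fst continuous_on_snd continuous_on_id)+
  define eqs where "eqs i = {ab :: ('i \<Rightarrow> 'a) \<times> ('i \<Rightarrow> 'a). fst ab i = snd ab i}" for i
  have closed_eqs: "closed (eqs i)" for i
    unfolding eqs_def by (rule closed_Collect_eq[OF coordf coords])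
  have "\<exists>M\<in>\<S>. \<forall>X\<in>\<S>. M \<subseteq> X \<longrightarrow> X = M"
  proof (rule subset_Zorn')
    fix C assume C: "subset.chain \<S> C"
    then have CS: "C \<subseteq> \<S>" by (auto simp: subset.chain_def)
    \<comment> \<open>A finite part of the union of a nonempty chain lies in one member, so the
      finite intersection property in the compact \<open>A \<times> B\<close> gives a pair agreeing
      on the whole union.\<close>
    have fip: "agree F \<noteq> {}" if F: "finite F" "F \<subseteq> \<Union>C" for F
    proof (cases "C = {}")
      case True
      then show ?thesis using F AB(4,5) by (auto simp: agree_def)
    next
      case False
      obtain S where S: "S \<in> C" "F \<subseteq> S"
        by (rule finite_subset_Union_chain[OF F False C])
      then have "agree S \<noteq> {}" using CS unfolding \<S>_def by blast
      moreover have "agree S \<subseteq> agree F" using S(2) unfolding agree_def by blast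
      ultimately show ?thesis by blast
    qed
    have "(A \<times> B) \<inter> \<Inter> (eqs ` \<Union>C) \<noteq> {}"
    proof (rule compact_imp_fip)
      show "compact (A \<times> B)" using AB by (intro compact_Times)
      show "closed T" if "T \<in> eqs ` \<Union>C" for T
        using that closed_eqs by blast
      fix F' assume "finite F'" "F' \<subseteq> eqs ` \<Union>C"
      then obtain F where F: "finite F" "F \<subseteq> \<Union>C" "F' = eqs ` F"
        by (meson finite_subset_image)
      show "(A \<times> B) \<inter> \<Inter> F' \<noteq> {}"
        using fip[OF F(1,2)] unfolding F(3) agree_def eqs_def by blast
    qed
    then obtain ab where "ab \<in> (A \<times> B) \<inter> \<Inter> (eqs ` \<Union>C)"
      unfolding ex_in_conv[symmetric] by (elim exE)
    then have "ab \<in> agree (\<Union>C)" unfolding agree_def eqs_def by simp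
    then have "agree (\<Union>C) \<noteq> {}" by blast
    moreover have "j \<in> \<Union>C" if "i \<in> \<Union>C" "(j, i) \<in> r" for i j
    proof -
      obtain S where "S \<in> C" "i \<in> S" using \<open>i \<in> \<Union>C\<close> by (rule UnionE)
      moreover have "S \<in> \<S>" using CS \<open>S \<in> C\<close> by (rule subsetD)
      ultimately have "j \<in> S" using that(2) unfolding \<S>_def by blast
      then show ?thesis using \<open>S \<in> C\<close> by (rule UnionI[rotated])
    qed
    ultimately show "\<Union>C \<in> \<S>" unfolding \<S>_def by blast
  qed
  then obtain S where S: "S \<in> \<S>" and maxS: "\<And>X. X \<in> \<S> \<Longrightarrow> S \<subseteq> X \<Longrightarrow> X = S" by blast
  from S have "agree S \<noteq> {}" unfolding \<S>_def by blast
  then obtain a b where ab: "a \<in> A" "b \<in> B" "\<And>i. i \<in> S \<Longrightarrow> a i = b i"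
    unfolding agree_def by auto
  from S have down: "\<And>i j. i \<in> S \<Longrightarrow> (j, i) \<in> r \<Longrightarrow> j \<in> S" unfolding \<S>_def by blast
  have "S \<noteq> UNIV"
  proof
    assume "S = UNIV"
    then have "a = b" using ab(3) by (intro ext) simp
    then show False using ab(1,2) AB(3) by blast
  qed
  then obtain i0 where "i0 \<in> - S" by blast
  then obtain i where i: "i \<notin> S" and pred: "\<And>j. (j, i) \<in> r \<Longrightarrow> j \<in> S"
    using wfE_min[OF wf, of i0 "- S"] by auto
  have Phi_i: "\<Phi> i z = \<Phi> i a" if "\<And>j. j \<in> S \<Longrightarrow> z j = a j" for z
    by (rule dep) (use that pred in blast)
  define fib where "fib D = (\<lambda>z. z i) ` {z \<in> D. \<forall>j\<in>S. z j = a j}" for D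
  have fib_closed: "closed (fib D)" if "compact D" for D
  proof -
    have "{z \<in> D. \<forall>j\<in>S. z j = a j} = D \<inter> (\<Inter>j\<in>S. {z. z j = a j})" by auto
    then have "compact {z \<in> D. \<forall>j\<in>S. z j = a j}"
      using that by (auto intro!: compact_Int_closed closed_INT closed_Collect_eq)
    then have "compact (fib D)" unfolding fib_def
      by (rule compact_continuous_image[rotated])
        (rule continuous_on_subset[OF continuous_on_product_coordinates subset_UNIV])
    then show ?thesis by (rule compact_imp_closed)
  qed
  \<comment> \<open>Every admissible value at \<open>i\<close> extends to a full solution, which
    lies in \<open>A\<close> or in \<open>B\<close>.\<close>
  have "\<Phi> i a \<subseteq> fib A \<union> fib B"
  proof
    fix t assume t: "t \<in> \<Phi> i a"
    let ?a = "a(i := t)"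
    have down': "k \<in> S" if "j \<in> insert i S" "(k, j) \<in> r" for j k
      using that down pred by blast
    have eqa: "\<Phi> j ?a = \<Phi> j a" if "j \<in> insert i S" for j
    proof (rule dep)
      fix k assume "(k, j) \<in> r"
      then have "k \<noteq> i" using down'[OF that] i by blast
      then show "?a k = a k" by simp
    qed
    obtain z where z: "\<And>j. j \<in> insert i S \<Longrightarrow> z j = ?a j" "\<And>j. z j \<in> \<Phi> j z"
    proof (rule constraint_system_extend[where \<Phi> = \<Phi> and S = "insert i S" and a = ?a, OF wf dep ne])
      show "k \<in> insert i S" if "j \<in> insert i S" "(k, j) \<in> r" for j k
        using down'[OF that] by blast
      show "?a j \<in> \<Phi> j ?a" if "j \<in> insert i S" for j
        using eqa[OF that] t that i ab(1) by (auto simp: A_def)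
    qed auto
    have "z \<in> A \<union> B" using z(2) AB(6) by blast
    moreover have "\<forall>j\<in>S. z j = a j" using z(1) i by auto
    moreover have "z i = t" using z(1)[of i] by simp
    ultimately show "t \<in> fib A \<union> fib B" unfolding fib_def by blast
  qed
  moreover have "a i \<in> fib A \<inter> \<Phi> i a" "b i \<in> fib B \<inter> \<Phi> i a"
    using ab Phi_i[of b] unfolding fib_def A_def B_def by auto
  ultimately have "fib A \<inter> fib B \<noteq> {}"
    using connected_closedD[OF conn[of i a], of "fib A" "fib B"] fib_closed AB(1,2) by blast
  then obtain a' b' where "a' \<in> A" "b' \<in> B" "a' i = b' i"
    "\<And>j. j \<in> S \<Longrightarrow> a' j = a j" "\<And>j. j \<in> S \<Longrightarrow> b' j = a j"
    unfolding fib_def by auto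
  then have "(a', b') \<in> agree (insert i S)" by (auto simp: agree_def)
  then have "agree (insert i S) \<noteq> {}" by blast
  moreover have "\<forall>j k. j \<in> insert i S \<longrightarrow> (k, j) \<in> r \<longrightarrow> k \<in> insert i S"
    using down pred by blast
  ultimately have "insert i S \<in> \<S>" unfolding \<S>_def by blast
  then show False using maxS[of "insert i S"] i by blast
qed

text \<open>Coordinates are added one at a time, each in the context \<open>G\<close> of those already present;
  what a pair requires lies strictly below both of its members, so well-foundedness bounds
  the process.\<close>

lemma finite_closure_in_context:
  fixes R :: "'i \<Rightarrow> 'i \<Rightarrow> 'i set"
  assumes wf: "wf r"
    and fin: "\<And>i j. finite (R i j)"
    and sym: "\<And>i j. R i j = R j i"
    and below: "\<And>i j k. k \<in> R i j \<Longrightarrow> (k, i) \<in> r"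
    and "finite N" "finite G"
  shows "\<exists>H. finite H \<and> N \<subseteq> H \<and> (\<forall>s\<in>H. \<forall>t\<in>G \<union> H. R s t \<subseteq> G \<union> H)"
proof -
  \<comment> \<open>Quantifying over the context \<open>G\<close> lets closures be built one after
    another, each in the context enlarged by the previous ones.\<close>
  define Q where "Q N \<longleftrightarrow> (\<forall>G. finite G \<longrightarrow>
    (\<exists>H. finite H \<and> N \<subseteq> H \<and> (\<forall>s\<in>H. \<forall>t\<in>G \<union> H. R s t \<subseteq> G \<union> H)))" for N
  have many: "Q N" if "finite N" "\<And>n. n \<in> N \<Longrightarrow> Q {n}" for N
    using that
  proof (induction N)
    case empty
    show ?case unfolding Q_def by blast
  next
    case (insert n N)
    show ?case unfolding Q_def
    proof (intro allI impI)
      fix G :: "'i set" assume G: "finite G"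
      obtain H1 where H1: "finite H1" "N \<subseteq> H1" "\<forall>s\<in>H1. \<forall>t\<in>G \<union> H1. R s t \<subseteq> G \<union> H1"
        using insert.IH[OF insert.prems, OF insertI2, simplified, unfolded Q_def, rule_format, OF G]
        by (elim exE conjE) (rule that)
      have "Q {n}" "finite (G \<union> H1)" using insert.prems G H1(1) by auto
      from this(1)[unfolded Q_def, rule_format, OF this(2)]
      obtain H2 where H2: "finite H2" "{n} \<subseteq> H2"
        "\<forall>s\<in>H2. \<forall>t\<in>(G \<union> H1) \<union> H2. R s t \<subseteq> (G \<union> H1) \<union> H2"
        by (elim exE conjE) (rule that)
      have "R s t \<subseteq> G \<union> (H1 \<union> H2)" if "s \<in> H1 \<union> H2" "t \<in> G \<union> (H1 \<union> H2)" for s t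
      proof (cases "s \<in> H2")
        case True
        then show ?thesis using H2(3) that by blast
      next
        case False
        then have s: "s \<in> H1" using that by blast
        show ?thesis
        proof (cases "t \<in> H2")
          case True
          then show ?thesis using H2(3) s sym[of s t] by blast
        next
          case False
          then show ?thesis using H1(3) s that by blast
        qed
      qed
      then have "\<forall>s\<in>H1 \<union> H2. \<forall>t\<in>G \<union> (H1 \<union> H2). R s t \<subseteq> G \<union> (H1 \<union> H2)"
        by (intro ballI)
      moreover have "finite (H1 \<union> H2)" "insert n N \<subseteq> H1 \<union> H2"
        using H1(1,2) H2(1,2) by auto
      ultimately show "\<exists>H. finite H \<and> insert n N \<subseteq> H \<and> (\<forall>s\<in>H. \<forall>t\<in>G \<union> H. R s t \<subseteq> G \<union> H)"
        by (intro exI conjI)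
    qed
  qed
  have QD: "\<exists>H. finite H \<and> N \<subseteq> H \<and> (\<forall>s\<in>H. \<forall>t\<in>G \<union> H. R s t \<subseteq> G \<union> H)"
    if "Q N" "finite G" for N G
    using that unfolding Q_def by blast
  have "Q {i}" for i
    using wf
  proof (induction i rule: wf_induct_rule)
    case (less i)
    show ?case unfolding Q_def
    proof (intro allI impI)
      fix G :: "'i set" assume G: "finite G"
      \<comment> \<open>All demands of \<open>i\<close> against itself and the context. They lie
        strictly below \<open>i\<close>, so they can be closed up in the context
        \<open>insert i G\<close>.\<close>
      define N where "N = (\<Union>t\<in>insert i G. R i t)"
      have "finite N" using G fin by (simp add: N_def)
      moreover have "Q {n}" if "n \<in> N" for n
        using that less below unfolding N_def by blast
      ultimately have QN: "Q N" by (rule many)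
      have "finite (insert i G)" using G by simp
      from QD[OF QN this] obtain H where H: "finite H" "N \<subseteq> H"
        "\<forall>s\<in>H. \<forall>t\<in>insert i G \<union> H. R s t \<subseteq> insert i G \<union> H"
        by (elim exE conjE) (rule that)
      have "R s t \<subseteq> G \<union> insert i H" if s: "s \<in> insert i H" and t: "t \<in> G \<union> insert i H" for s t
      proof (cases "s \<in> H")
        case True
        moreover have "t \<in> insert i G \<union> H" using t by blast
        ultimately have "R s t \<subseteq> insert i G \<union> H" using H(3) by blast
        then show ?thesis by blast
      next
        case False
        then have si: "s = i" using s by blast
        show ?thesis
        proof (cases "t \<in> H")
          case True
          then have "R t i \<subseteq> insert i G \<union> H" using H(3) by blast
          then show ?thesis using si sym[of i t] by blast
        next
          case False
          then have "R i t \<subseteq> N" using t unfolding N_def by blast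
          then show ?thesis using H(2) si by blast
        qed
      qed
      then have "\<forall>s\<in>insert i H. \<forall>t\<in>G \<union> insert i H. R s t \<subseteq> G \<union> insert i H"
        by (intro ballI)
      moreover have "finite (insert i H)" "{i} \<subseteq> insert i H" using H(1) by auto
      ultimately show "\<exists>H. finite H \<and> {i} \<subseteq> H \<and> (\<forall>s\<in>H. \<forall>t\<in>G \<union> H. R s t \<subseteq> G \<union> H)"
        by (intro exI conjI)
    qed
  qed
  then have "Q N" by (rule many[OF assms(5)])
  then show ?thesis by (rule QD[OF _ assms(6)])
qed

section \<open>The space\<close>

text \<open>\<open>Free l\<close> does not depend on the coordinates occurring in \<open>l\<close>; naming free coordinates by
  finite lists makes the sets of free coordinates used by distinct \<open>T\<close> almost disjoint.\<close>

datatype idx = Free "(idx \<times> real \<times> bool \<times> bool) list" | Task "nat \<Rightarrow> idx \<times> real \<times> bool \<times> bool"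

definition pref :: "(nat \<Rightarrow> 'a) \<Rightarrow> nat \<Rightarrow> 'a list" where
  "pref T n = map T [0..<n]"

text \<open>In \<open>Sol\<close> a free coordinate only has to lie in the unit interval. It is
  given predecessors because the conditions put on it in the neighbourhood systems read
  \<open>stop\<close>, \<open>remaining\<close> and \<open>partial_sum\<close> at its index.\<close>

definition dep :: "(idx \<times> idx) set" where
  "dep = {(j, i). case i of
      Free l \<Rightarrow> j \<in> fst ` set l \<union> (\<lambda>k. Free (take k l)) ` {..<length l}
    | Task T \<Rightarrow> j \<in> range (\<lambda>n. fst (T n)) \<union> range (\<lambda>n. Free (pref T n))}"

lemma dep_Task: "(fst (T n), Task T) \<in> dep" "(Free (pref T n), Task T) \<in> dep"
  by (auto simp: dep_def)

lemma dep_Free_pref: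
  assumes "j < n"
  shows "(fst (T j), Free (pref T n)) \<in> dep" "(Free (pref T j), Free (pref T n)) \<in> dep"
proof -
  show "(fst (T j), Free (pref T n)) \<in> dep" using assms by (auto simp: dep_def pref_def)
  have "pref T j = take j (pref T n)" "j < length (pref T n)" using assms by (simp_all add: pref_def take_map)
  then show "(Free (pref T j), Free (pref T n)) \<in> dep" unfolding dep_def by auto
qed

lemma fsts_fst: "fst e \<in> Basic_BNFs.fsts e"
  by (rule fsts.intros)

text \<open>Structural induction handles the entries; proper prefixes of a list are not subterms and
  need the inner induction on length.\<close>

lemma wf_dep: "wf dep"
proof -
  have free: "Free l \<in> Wellfounded.acc dep" if "\<And>e. e \<in> set l \<Longrightarrow> fst e \<in> Wellfounded.acc dep" for l
    using that
  proof (induction "length l" arbitrary: l rule: less_induct)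
    case less
    show ?case
    proof (rule acc.accI)
      fix j assume "(j, Free l) \<in> dep"
      then consider "j \<in> fst ` set l" | k where "k < length l" "j = Free (take k l)"
        by (auto simp: dep_def)
      then show "j \<in> Wellfounded.acc dep"
      proof cases
        case 2
        have "Free (take k l) \<in> Wellfounded.acc dep"
        proof (rule less.hyps)
          show "length (take k l) < length l" using 2(1) by simp
          show "fst e \<in> Wellfounded.acc dep" if "e \<in> set (take k l)" for e
            by (rule less.prems) (rule in_set_takeD[OF that])
        qed
        then show ?thesis using 2(2) by simp
      qed (use less.prems in auto)
    qed
  qed
  have "i \<in> Wellfounded.acc dep" for i
  proof (induction i)
    case (Free l)
    show ?case
      by (rule free) (rule Free, assumption, rule fsts_fst)
  next
    case (Task T)
    have D: "fst (T n) \<in> Wellfounded.acc dep" for n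
      by (rule Task[OF rangeI fsts_fst])
    show ?case
    proof (rule acc.accI)
      fix j assume "(j, Task T) \<in> dep"
      then consider n where "j = fst (T n)" | n where "j = Free (pref T n)"
        by (auto simp: dep_def)
      then show "j \<in> Wellfounded.acc dep"
      proof cases
        case (2 n)
        show ?thesis unfolding 2
        proof (rule free)
          fix e assume "e \<in> set (pref T n)"
          then obtain m where "e = T m" by (auto simp: pref_def)
          then show "fst e \<in> Wellfounded.acc dep" using D by simp
        qed
      qed (simp add: D)
    qed
  qed
  then show ?thesis by (simp add: wf_iff_acc)
qed

section \<open>Gates: monotone piecewise linear maps onto the unit interval\<close>

definition clamp01 :: "real \<Rightarrow> real" where
  "clamp01 t = max 0 (min 1 t)"

text \<open>\<open>fst b\<close> puts the ramp on the left or the right half of the unit interval,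
  \<open>snd b\<close> makes it rise or fall. Every point lies on a flat piece of some ramp, so
  \<open>tuned\<close> can force the value 0 or 1 there.\<close>

definition gate :: "bool \<times> bool \<Rightarrow> real \<Rightarrow> real" where
  "gate b t = (let s = clamp01 (if fst b then 2 * t else 2 * t - 1) in if snd b then s else 1 - s)"

definition tuned :: "bool \<Rightarrow> real \<Rightarrow> bool \<times> bool" where
  "tuned w t = (t \<ge> 1/2, w = (t \<ge> 1/2))"

lemma gate_tuned: "gate (tuned w t) t = (if w then 1 else 0)"
  by (auto simp: gate_def tuned_def clamp01_def)

lemma clamp01_range: "0 \<le> clamp01 t" "clamp01 t \<le> 1"
  by (auto simp: clamp01_def)

lemma gate_range: "0 \<le> gate b t" "gate b t \<le> 1"
  by (auto simp: gate_def Let_def clamp01_def)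

lemma continuous_on_clamp01 [continuous_intros]:
  "continuous_on S f \<Longrightarrow> continuous_on S (\<lambda>x. clamp01 (f x))"
  unfolding clamp01_def by (intro continuous_intros)

lemma continuous_on_gate [continuous_intros]:
  "continuous_on S f \<Longrightarrow> continuous_on S (\<lambda>x. gate b (f x))"
  by (cases "fst b"; cases "snd b") (auto simp: gate_def Let_def intro!: continuous_intros)

text \<open>Each gate is monotone. This keeps the admissible values of a free coordinate an
  interval.\<close>

lemma gate_between:
  assumes "r \<le> s" "s \<le> t"
  shows "min (gate b r) (gate b t) \<le> gate b s" "gate b s \<le> max (gate b r) (gate b t)"
  using assms by (auto simp: gate_def Let_def clamp01_def)

lemma gate_surj:
  assumes "0 \<le> v" "v \<le> 1"
  obtains t where "0 \<le> t" "t \<le> 1" "gate b t = v"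
proof -
  define w where "w = (if snd b then v else 1 - v)"
  define t where "t = (if fst b then w / 2 else (w + 1) / 2)"
  show thesis
    by (rule that[of t]) (use assms in \<open>auto simp: t_def w_def gate_def Let_def clamp01_def field_simps\<close>)
qed

text \<open>\<open>stop T n y\<close> is the conditional weight given to index \<open>n\<close> when the earlier indices have been
  passed over. It vanishes near the points with \<open>y (d\<^sub>j) = x\<^sub>j\<close> for \<open>j < n\<close>, and if \<open>y (d\<^sub>j) \<noteq> x\<^sub>j\<close> for
  some \<open>j\<close> it is eventually 1, so that the remaining weight becomes 0.\<close>

definition stop :: "(nat \<Rightarrow> idx \<times> real \<times> bool \<times> bool) \<Rightarrow> nat \<Rightarrow> (idx \<Rightarrow> real) \<Rightarrow> real" where
  "stop T n y = clamp01 (real n * (\<Sum>j<n. \<bar>y (fst (T j)) - fst (snd (T j))\<bar>) - 1)"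

text \<open>Stick breaking: index \<open>n\<close> takes the fraction \<open>stop T n y\<close> of
  the unit mass still left.\<close>

primrec remaining :: "(nat \<Rightarrow> idx \<times> real \<times> bool \<times> bool) \<Rightarrow> nat \<Rightarrow> (idx \<Rightarrow> real) \<Rightarrow> real" where
  "remaining T 0 y = 1"
| "remaining T (Suc n) y = (1 - stop T n y) * remaining T n y"

primrec partial_sum :: "(nat \<Rightarrow> idx \<times> real \<times> bool \<times> bool) \<Rightarrow> nat \<Rightarrow> (idx \<Rightarrow> real) \<Rightarrow> real" where
  "partial_sum T 0 y = 0"
| "partial_sum T (Suc n) y =
    partial_sum T n y + stop T n y * remaining T n y * gate (snd (snd (T n))) (y (Free (pref T n)))"

text \<open>The window is the single limit of the partial sums if the remaining weight ever becomes 0,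
  and \<open>[0,1]\<close> at the points where the new coordinate is unconstrained.\<close>

definition window :: "(nat \<Rightarrow> idx \<times> real \<times> bool \<times> bool) \<Rightarrow> (idx \<Rightarrow> real) \<Rightarrow> real set" where
  "window T y = {t. \<forall>n. partial_sum T n y \<le> t \<and> t \<le> partial_sum T n y + remaining T n y}"

definition Sol :: "(idx \<Rightarrow> real) set" where
  "Sol = {y. (\<forall>l. y (Free l) \<in> {0..1}) \<and> (\<forall>T. y (Task T) \<in> window T y)}"

section \<open>Nested intervals and their intersection, the window\<close>

lemma stop_range: "0 \<le> stop T n y" "stop T n y \<le> 1"
  by (simp_all add: stop_def clamp01_range)

lemma remaining_range: "0 \<le> remaining T n y" "remaining T n y \<le> 1"
proof (induction n)
  case (Suc n)
  case 1 show ?case using Suc stop_range[of T n y] by simp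
  case 2 show ?case using Suc stop_range[of T n y] by (simp add: mult_le_one)
qed simp_all

text \<open>A gate value in the unit interval adds at most the weight given out at \<open>n\<close>,
  so the intervals from \<open>partial_sum\<close> to \<open>partial_sum + remaining\<close> are
  nested.\<close>

lemma partial_sum_Suc:
  "partial_sum T n y \<le> partial_sum T (Suc n) y"
  "partial_sum T (Suc n) y + remaining T (Suc n) y \<le> partial_sum T n y + remaining T n y"
proof -
  let ?c = "stop T n y * remaining T n y" and ?g = "gate (snd (snd (T n))) (y (Free (pref T n)))"
  have c: "0 \<le> ?c" by (simp add: stop_range remaining_range)
  show "partial_sum T n y \<le> partial_sum T (Suc n) y" using c gate_range by simp
  have "?c * ?g \<le> ?c * 1" using c gate_range by (intro mult_left_mono) auto
  then show "partial_sum T (Suc n) y + remaining T (Suc n) y \<le> partial_sum T n y + remaining T n y"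
    by (simp add: algebra_simps)
qed

lemma partial_sum_mono: "n \<le> m \<Longrightarrow> partial_sum T n y \<le> partial_sum T m y"
  by (rule lift_Suc_mono_le[of "\<lambda>n. partial_sum T n y"]) (rule partial_sum_Suc)

lemma partial_sum_remaining_antimono: "n \<le> m \<Longrightarrow> partial_sum T m y + remaining T m y \<le> partial_sum T n y + remaining T n y"
  by (rule lift_Suc_antimono_le[of "\<lambda>n. partial_sum T n y + remaining T n y"]) (rule partial_sum_Suc)

lemma partial_sum_le_upper: "partial_sum T n y \<le> partial_sum T m y + remaining T m y"
proof (cases "n \<le> m")
  case True
  then show ?thesis using partial_sum_mono[OF True, of T y] remaining_range(1)[of T m y] by linarith
next
  case False
  then have "m \<le> n" by simp
  then show ?thesis using partial_sum_remaining_antimono[of m n T y] remaining_range(1)[of T n y] by linarith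
qed

text \<open>By nestedness every lower end is below every upper end; the supremum of the lower ends,
  raised to \<open>a\<close> if necessary, lies in all the intervals.\<close>

lemma window_meets:
  assumes "a \<le> b" "\<And>n. partial_sum T n y \<le> b" "\<And>n. a \<le> partial_sum T n y + remaining T n y"
  shows "\<exists>t \<in> window T y. a \<le> t \<and> t \<le> b"
proof -
  define t where "t = max a (SUP n. partial_sum T n y)"
  have bdd: "bdd_above (range (\<lambda>n. partial_sum T n y))"
    using assms(2) by (intro bdd_aboveI) auto
  have "partial_sum T n y \<le> t" for n
    unfolding t_def using cSUP_upper[OF _ bdd, of n] by auto
  moreover have "t \<le> partial_sum T n y + remaining T n y" for n
    unfolding t_def using assms(3) partial_sum_le_upper by (auto intro: cSUP_least)
  moreover have "t \<le> b" unfolding t_def using assms(1,2) by (auto intro: cSUP_least)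
  moreover have "a \<le> t" by (simp add: t_def)
  ultimately show ?thesis by (auto simp: window_def)
qed

lemma window_subset: "window T y \<subseteq> {0..1}"
  unfolding window_def by (auto dest: spec[of _ 0])

lemma window_nonempty: "window T y \<noteq> {}"
proof -
  have "partial_sum T n y \<le> 1" "0 \<le> partial_sum T n y + remaining T n y" for n
    using partial_sum_le_upper[of T n y 0] partial_sum_le_upper[of T 0 y n] by auto
  then show ?thesis using window_meets[of 0 1 T y] by auto
qed

lemma window_remaining_zero: "remaining T n y = 0 \<Longrightarrow> t \<in> window T y \<Longrightarrow> t = partial_sum T n y"
  unfolding window_def by (auto dest: spec[of _ n])

lemma stop_cong:
  "(\<And>j. j < n \<Longrightarrow> y (fst (T j)) = y' (fst (T j))) \<Longrightarrow> stop T n y = stop T n y'"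
  by (simp add: stop_def)

lemma remaining_cong:
  "(\<And>j. j < n \<Longrightarrow> y (fst (T j)) = y' (fst (T j))) \<Longrightarrow> remaining T n y = remaining T n y'"
proof (induction n)
  case (Suc n)
  then show ?case using stop_cong[of n y T y'] by simp
qed simp

lemma partial_sum_cong:
  "(\<And>j. j < n \<Longrightarrow> y (fst (T j)) = y' (fst (T j))) \<Longrightarrow>
   (\<And>j. j < n \<Longrightarrow> y (Free (pref T j)) = y' (Free (pref T j))) \<Longrightarrow> partial_sum T n y = partial_sum T n y'"
proof (induction n)
  case (Suc n)
  then show ?case using stop_cong[of n y T y'] remaining_cong[of n y T y'] by simp
qed simp

lemma window_cong:
  assumes "\<And>j. (j, Task T) \<in> dep \<Longrightarrow> y j = y' j"
  shows "window T y = window T y'"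
proof -
  have "partial_sum T n y = partial_sum T n y'" "remaining T n y = remaining T n y'" for n
    by (rule partial_sum_cong remaining_cong; use assms in \<open>force simp: dep_def\<close>)+
  then show ?thesis by (simp add: window_def)
qed

lemma continuous_on_stop: "continuous_on UNIV (stop T n)"
  unfolding stop_def by (intro continuous_intros continuous_on_product_coordinates)

lemma continuous_on_remaining: "continuous_on UNIV (remaining T n)"
  by (induction n) (auto intro!: continuous_intros continuous_on_stop[unfolded fun_eq_iff])

lemma continuous_on_partial_sum: "continuous_on UNIV (partial_sum T n)"
proof (induction n)
  case (Suc n)
  show ?case unfolding partial_sum.simps
    by (intro continuous_intros Suc continuous_on_stop continuous_on_remaining continuous_on_product_coordinates)
qed (simp add: continuous_on_const)

section \<open>Compactness and connectedness of the solution set\<close>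

lemma connected_order_convex:
  fixes S :: "real set"
  assumes "\<And>a b x. a \<in> S \<Longrightarrow> b \<in> S \<Longrightarrow> a \<le> x \<Longrightarrow> x \<le> b \<Longrightarrow> x \<in> S"
  shows "connected S"
proof -
  have "is_interval S" unfolding is_interval_1 using assms by blast
  then show ?thesis by (rule is_interval_connected)
qed

lemma window_order_convex: "a \<in> window T y \<Longrightarrow> b \<in> window T y \<Longrightarrow> a \<le> x \<Longrightarrow> x \<le> b \<Longrightarrow> x \<in> window T y"
  unfolding window_def mem_Collect_eq by (meson order_trans)

lemma connected_window: "connected (window T y)"
  by (rule connected_order_convex) (rule window_order_convex)

lemma Sol_range: "y \<in> Sol \<Longrightarrow> y i \<in> {0..1}"
proof (cases i)
  case (Task T)
  assume "y \<in> Sol"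
  then have "y (Task T) \<in> window T y" by (simp add: Sol_def)
  then show ?thesis using window_subset[of T y] Task by blast
qed (simp add: Sol_def)

lemma closed_Sol: "closed Sol"
proof -
  have "Sol = (\<Inter>l. {y. 0 \<le> y (Free l)}) \<inter> (\<Inter>l. {y. y (Free l) \<le> 1}) \<inter>
      (\<Inter>T. \<Inter>n. {y. partial_sum T n y \<le> y (Task T)}) \<inter>
      (\<Inter>T. \<Inter>n. {y. y (Task T) \<le> partial_sum T n y + remaining T n y})"
    by (auto simp: Sol_def window_def)
  moreover have "closed \<dots>"
    by (intro closed_Int closed_INT ballI closed_Collect_le continuous_intros
        continuous_on_partial_sum continuous_on_remaining continuous_on_product_coordinates)
  ultimately show ?thesis by simp
qed

lemma compact_Sol: "compact Sol"
proof -
  have "compactin (product_topology (\<lambda>i::idx. euclidean) UNIV) (Pi\<^sub>E UNIV (\<lambda>i. {0..1::real}))"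
    by (subst compactin_PiE) simp
  then have "compact (Pi\<^sub>E UNIV (\<lambda>i::idx. {0..1::real}))"
    by (simp add: euclidean_product_topology)
  then have "compact (Pi\<^sub>E UNIV (\<lambda>i::idx. {0..1::real}) \<inter> Sol)"
    using closed_Sol by (rule compact_Int_closed)
  moreover have "Pi\<^sub>E UNIV (\<lambda>i::idx. {0..1::real}) \<inter> Sol = Sol"
    using Sol_range by (auto simp: PiE_def Pi_def)
  ultimately show ?thesis by simp
qed

definition allowed :: "idx \<Rightarrow> (idx \<Rightarrow> real) \<Rightarrow> real set" where
  "allowed i y = (case i of Free l \<Rightarrow> {0..1} | Task T \<Rightarrow> window T y)"

lemma Sol_eq_allowed: "Sol = {y. \<forall>i. y i \<in> allowed i y}"
  unfolding Sol_def allowed_def by (auto split: idx.splits)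

lemma allowed_cong:
  assumes "\<And>j. (j, i) \<in> dep \<Longrightarrow> y j = y' j"
  shows "allowed i y = allowed i y'"
proof (cases i)
  case (Task T)
  have "window T y = window T y'" by (rule window_cong) (rule assms, simp add: Task)
  then show ?thesis by (simp add: allowed_def Task)
qed (simp add: allowed_def)

lemma allowed_nonempty: "allowed i y \<noteq> {}"
  by (cases i) (simp_all add: allowed_def window_nonempty)

lemma connected_allowed: "connected (allowed i y)"
  by (cases i) (simp_all add: allowed_def connected_window)

lemma connected_Sol: "connected Sol"
  unfolding Sol_eq_allowed
  by (rule constraint_system_connected[OF wf_dep allowed_cong allowed_nonempty connected_allowed])
    (simp_all add: compact_Sol flip: Sol_eq_allowed)

text \<open>\<open>Free []\<close> has no predecessors, so its value may be prescribed. This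
  provides two distinct points.\<close>

lemma Sol_prescribed_Free_Nil:
  assumes "0 \<le> t" "t \<le> 1"
  obtains y where "y \<in> Sol" "y (Free []) = t"
proof -
  obtain z where z: "\<And>i. i \<in> {Free []} \<Longrightarrow> z i = t" "\<And>i. z i \<in> allowed i z"
    by (rule constraint_system_extend[where \<Phi> = allowed and S = "{Free []}" and a = "\<lambda>_. t",
          OF wf_dep allowed_cong allowed_nonempty])
      (use assms in \<open>auto simp: dep_def allowed_def\<close>)
  then show thesis using that[of z] by (simp add: Sol_eq_allowed)
qed

lemma open_fun_box:
  fixes W :: "('i \<Rightarrow> real) set"
  assumes "open W" "u \<in> W"
  obtains F \<delta> where "finite F" "\<delta> > 0" "\<And>y. (\<And>i. i \<in> F \<Longrightarrow> \<bar>y i - u i\<bar> < \<delta>) \<Longrightarrow> y \<in> W"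
proof -
  have "openin (product_topology (\<lambda>i::'i. euclidean::real topology) UNIV) W"
    using assms(1) by (simp add: euclidean_product_topology)
  from product_topology_open_contains_basis[OF this assms(2)]
  obtain X where X: "u \<in> Pi\<^sub>E UNIV X" "\<And>i. open (X i)" "finite {i. X i \<noteq> UNIV}" "Pi\<^sub>E UNIV X \<subseteq> W"
    by auto
  have "\<exists>d>0. \<forall>t. \<bar>t - u i\<bar> < d \<longrightarrow> t \<in> X i" for i
    using X(1) X(2)[of i] by (auto simp: open_dist dist_real_def PiE_def Pi_def)
  then obtain d where d: "\<And>i. d i > 0" "\<And>i t. \<bar>t - u i\<bar> < d i \<Longrightarrow> t \<in> X i"
    by metis
  define F where "F = {i. X i \<noteq> UNIV}"
  define \<delta> where "\<delta> = Min (insert 1 (d ` F))"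
  have fin: "finite F" using X(3) by (simp add: F_def)
  have "\<delta> > 0" unfolding \<delta>_def using fin d(1) by (subst Min_gr_iff) auto
  moreover have "y \<in> W" if y: "\<And>i. i \<in> F \<Longrightarrow> \<bar>y i - u i\<bar> < \<delta>" for y
  proof -
    have "y i \<in> X i" for i
    proof (cases "i \<in> F")
      case True
      then have "\<delta> \<le> d i" unfolding \<delta>_def using fin by (intro Min_le) auto
      then show ?thesis using y[OF True] d(2)[of "y i" i] by simp
    next
      case False
      then show ?thesis by (simp add: F_def)
    qed
    then show ?thesis using X(4) by (auto simp: PiE_def Pi_def)
  qed
  ultimately show thesis using that fin by blast
qed

section \<open>Connected neighbourhoods\<close>

text \<open>A settled coordinate is near \<open>u\<close> a continuous function of finitely many of its predecessors,
  up to a small error.\<close>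

definition settled :: "(idx \<Rightarrow> real) \<Rightarrow> idx \<Rightarrow> bool" where
  "settled u i \<longleftrightarrow> (\<exists>T n. i = Task T \<and> remaining T n u = 0)"

text \<open>For \<open>a \<le> b\<close> this says that the \<open>n\<close>-th nested interval
  still meets the target \<open>{a..b}\<close>.\<close>

definition feasible :: "real \<Rightarrow> real \<Rightarrow> (nat \<Rightarrow> idx \<times> real \<times> bool \<times> bool) \<Rightarrow> nat \<Rightarrow> (idx \<Rightarrow> real) \<Rightarrow> bool" where
  "feasible a b T n y \<longleftrightarrow> partial_sum T n y \<le> b \<and> a \<le> partial_sum T n y + remaining T n y"

text \<open>Gates are onto, so the next gate value can be chosen to keep the target within
  reach.\<close>

lemma feasible_step_solvable:
  assumes "feasible a b T n y" "a \<le> b"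
  obtains t where "0 \<le> t" "t \<le> 1"
    "partial_sum T n y + stop T n y * remaining T n y * gate g t \<le> b"
    "a \<le> partial_sum T n y + stop T n y * remaining T n y * gate g t + (1 - stop T n y) * remaining T n y"
proof -
  let ?P = "partial_sum T n y" and ?c = "stop T n y * remaining T n y" and ?R = "remaining T n y"
  have c: "0 \<le> ?c" "?P \<le> b" "a \<le> ?P + ?R"
    using assms by (auto simp: stop_range remaining_range feasible_def)
  have "\<exists>v. 0 \<le> v \<and> v \<le> 1 \<and> ?P + ?c * v \<le> b \<and> a \<le> ?P + ?c * v + (?R - ?c)"
  proof (cases "a \<le> ?P + (?R - ?c)")
    case True
    then show ?thesis using c by (intro exI[of _ 0]) auto
  next
    case False
    then have "?c > 0" using c by (cases "?c = 0") auto
    \<comment> \<open>This value puts the upper end of the next interval exactly at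
      \<open>a\<close>.\<close>
    define v where "v = (a - ?P - (?R - ?c)) / ?c"
    have "?c \<noteq> 0" using \<open>?c > 0\<close> by (rule less_imp_neq[symmetric])
    then have "?c * v = a - ?P - (?R - ?c)"
      unfolding v_def times_divide_eq_right by (rule nonzero_mult_div_cancel_left)
    moreover have "0 \<le> v" "v \<le> 1"
      using False c \<open>?c > 0\<close> by (auto simp: v_def divide_le_eq)
    moreover have "?c \<le> ?R"
      using mult_right_mono[OF stop_range(2)[of T n y] remaining_range(1)[of T n y]] by simp
    ultimately show ?thesis using assms(2) by (intro exI[of _ v]) auto
  qed
  then obtain v where v: "0 \<le> v" "v \<le> 1" "?P + ?c * v \<le> b" "a \<le> ?P + ?c * v + (?R - ?c)" by blast
  obtain t where "0 \<le> t" "t \<le> 1" "gate g t = v" using gate_surj v(1,2) by blast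
  then show thesis using that[of t] v(3,4) by (simp add: algebra_simps)
qed

text \<open>For \<open>n > j\<close> the sum is at least the deviation \<open>c > 0\<close> at
  \<open>j\<close>; once also \<open>n * c \<ge> 2\<close>, the clamped expression is at least
  1.\<close>

lemma stop_eventually_one:
  assumes "y (fst (T j)) \<noteq> fst (snd (T j))"
  obtains N where "\<And>n. n \<ge> N \<Longrightarrow> stop T n y = 1"
proof -
  let ?c = "\<bar>y (fst (T j)) - fst (snd (T j))\<bar>"
  have c: "?c > 0" using assms by simp
  obtain N where N: "2 / ?c < real N" using reals_Archimedean2 by blast
  have "stop T n y = 1" if n: "n \<ge> max N (Suc j)" for n
  proof -
    have "2 / ?c \<le> real n" using N n by simp
    then have "2 \<le> real n * ?c" using c by (simp add: divide_le_eq)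
    also have "?c \<le> (\<Sum>j<n. \<bar>y (fst (T j)) - fst (snd (T j))\<bar>)"
      by (rule member_le_sum[where f = "\<lambda>j. \<bar>y (fst (T j)) - fst (snd (T j))\<bar>"]) (use n in auto)
    then have "real n * ?c \<le> real n * (\<Sum>j<n. \<bar>y (fst (T j)) - fst (snd (T j))\<bar>)"
      by (intro mult_left_mono) auto
    finally show ?thesis by (simp add: stop_def clamp01_def)
  qed
  then show thesis by (rule that)
qed

lemma remaining_zero_mono:
  assumes "remaining T n y = 0" "n \<le> m"
  shows "remaining T m y = 0"
  using assms(2,1) by (induction rule: dec_induct) auto

text \<open>\<open>pair_closed\<close> leaves each free coordinate outside \<open>F\<close> to at
  most one \<open>T\<close> with \<open>Task T \<in> F\<close>. \<open>tau\<close> will make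
  \<open>stop\<close> vanish at indices of active \<open>T\<close> whose free coordinate is in
  \<open>F\<close>. \<open>settled_close\<close> passes control from unsettled coordinates to
  settled ones.\<close>

locale nbhd_system =
  fixes F :: "idx set" and u :: "idx \<Rightarrow> real" and \<eta> \<tau> :: real
  assumes u: "u \<in> Sol" and fin: "finite F" and eta: "0 < \<eta>" "\<eta> \<le> \<tau>"
    and free_closed: "Free l \<in> F \<Longrightarrow> (j, Free l) \<in> dep \<Longrightarrow> j \<in> F"
    and pair_closed: "Task T \<in> F \<Longrightarrow> Task T' \<in> F \<Longrightarrow> T \<noteq> T' \<Longrightarrow> pref T n = pref T' n \<Longrightarrow> Free (pref T n) \<in> F"
    and tau: "Free l \<in> F \<Longrightarrow> real (length l) * (real (length l) * \<tau>) \<le> 1"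
    and settled_close: "i \<in> F \<Longrightarrow> settled u i \<Longrightarrow> y \<in> Sol \<Longrightarrow>
      (\<And>j. j \<in> F \<Longrightarrow> (j, i) \<in> dep\<^sup>+ \<Longrightarrow> \<not> settled u j \<Longrightarrow> \<bar>y j - u j\<bar> \<le> \<eta>) \<Longrightarrow> \<bar>y i - u i\<bar> \<le> \<tau>"
begin

abbreviation "active T \<equiv> Task T \<in> F \<and> \<not> settled u (Task T)"
abbreviation "lo T \<equiv> u (Task T) - \<eta>"
abbreviation "hi T \<equiv> u (Task T) + \<eta>"

text \<open>Keeping a blown-up coordinate \<open>Task T\<close> within \<open>\<eta>\<close> of its value at \<open>u\<close> is translated into
  conditions on the free coordinates of \<open>T\<close> outside \<open>F\<close>: each of them must preserve the
  feasibility of that target.\<close>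

definition step_ok where
  "step_ok y t T n \<longleftrightarrow> (feasible (lo T) (hi T) T n y \<longrightarrow>
     partial_sum T n y + stop T n y * remaining T n y * gate (snd (snd (T n))) t \<le> hi T \<and>
     lo T \<le> partial_sum T n y + stop T n y * remaining T n y * gate (snd (snd (T n))) t + (1 - stop T n y) * remaining T n y)"

text \<open>Targets are imposed only where they can be met, here and in \<open>step_ok\<close>, so
  that no set is empty, whatever \<open>y\<close> is. At solutions the proviso turns out to hold for
  every active \<open>T\<close>.\<close>

definition \<Phi> :: "idx \<Rightarrow> (idx \<Rightarrow> real) \<Rightarrow> real set" where
  "\<Phi> i y = (case i of
     Free l \<Rightarrow> {t \<in> {0..1}. (Free l \<in> F \<longrightarrow> \<bar>t - u (Free l)\<bar> \<le> \<eta>) \<and>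
       (Free l \<notin> F \<longrightarrow> (\<forall>T n. active T \<and> l = pref T n \<longrightarrow> step_ok y t T n))}
   | Task T \<Rightarrow> {t \<in> window T y. active T \<and> (\<exists>s\<in>window T y. lo T \<le> s \<and> s \<le> hi T) \<longrightarrow> lo T \<le> t \<and> t \<le> hi T})"

text \<open>Settled coordinates carry no explicit bound; their predecessors keep them within
  \<open>\<tau>\<close>.\<close>

definition E :: "(idx \<Rightarrow> real) set" where
  "E = {y \<in> Sol. \<forall>i\<in>F. \<not> settled u i \<longrightarrow> \<bar>y i - u i\<bar> \<le> \<eta>}"

lemma step_ok_cong:
  assumes "\<And>j. (j, Free (pref T n)) \<in> dep \<Longrightarrow> y j = y' j"
  shows "step_ok y t T n = step_ok y' t T n"
proof -
  have D: "y (fst (T j)) = y' (fst (T j))" if "j < n" for j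
    by (rule assms) (rule dep_Free_pref[OF that])
  have C: "y (Free (pref T j)) = y' (Free (pref T j))" if "j < n" for j
    by (rule assms) (rule dep_Free_pref[OF that])
  show ?thesis
    using stop_cong[of n y T y'] remaining_cong[of n y T y'] partial_sum_cong[of n y T y'] D C
    by (simp add: step_ok_def feasible_def)
qed

lemma Phi_cong:
  assumes "\<And>j. (j, i) \<in> dep \<Longrightarrow> y j = y' j"
  shows "\<Phi> i y = \<Phi> i y'"
proof (cases i)
  case (Free l)
  have "step_ok y t T n = step_ok y' t T n" if "l = pref T n" for t T n
    by (rule step_ok_cong) (rule assms, simp add: Free that)
  then show ?thesis by (simp add: \<Phi>_def Free cong: conj_cong)
next
  case (Task T)
  have "window T y = window T y'" by (rule window_cong) (rule assms, simp add: Task)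
  then show ?thesis by (simp add: \<Phi>_def Task)
qed

lemma pref_inj: "pref T n = pref T' m \<Longrightarrow> n = m"
  by (metis length_map length_upt minus_nat.diff_0 pref_def)

lemma Phi_nonempty: "\<Phi> i y \<noteq> {}"
proof (cases i)
  case (Free l)
  show ?thesis
  proof (cases "Free l \<in> F")
    case True
    then have "u (Free l) \<in> \<Phi> i y" using Sol_range[OF u, of "Free l"] eta Free by (simp add: \<Phi>_def)
    then show ?thesis by blast
  next
    case lF: False
    show ?thesis
    proof (cases "\<exists>T n. active T \<and> l = pref T n \<and> feasible (lo T) (hi T) T n y")
      case True
      then obtain T n where T: "active T" "l = pref T n" "feasible (lo T) (hi T) T n y" by blast
      \<comment> \<open>By \<open>pair_closed\<close>, and because the length of a prefix determines
        its index, a single condition \<open>step_ok\<close> applies to this coordinate.\<close>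
      have uniq: "T' = T \<and> n' = n" if "active T'" "l = pref T' n'" for T' n'
        using that T lF pair_closed[of T T' n] pref_inj[of T n T' n'] by metis
      obtain t where "0 \<le> t" "t \<le> 1"
        "partial_sum T n y + stop T n y * remaining T n y * gate (snd (snd (T n))) t \<le> hi T"
        "lo T \<le> partial_sum T n y + stop T n y * remaining T n y * gate (snd (snd (T n))) t + (1 - stop T n y) * remaining T n y"
        by (rule feasible_step_solvable[OF T(3), of "snd (snd (T n))"]) (use eta in auto)
      then have "t \<in> \<Phi> i y" using uniq lF by (auto simp: \<Phi>_def Free step_ok_def)
      then show ?thesis by blast
    next
      case False
      then have "0 \<in> \<Phi> i y" using lF by (auto simp: \<Phi>_def Free step_ok_def)
      then show ?thesis by blast
    qed
  qed
next
  case (Task T)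
  then show ?thesis using window_nonempty[of T y] by (auto simp: \<Phi>_def)
qed

text \<open>The tested expressions are nondecreasing affine functions of the gate value, and the
  gate is monotone.\<close>

lemma step_ok_order_convex:
  assumes "step_ok y r T n" "step_ok y t T n" "r \<le> s" "s \<le> t"
  shows "step_ok y s T n"
proof -
  let ?c = "stop T n y * remaining T n y" and ?g = "gate (snd (snd (T n)))"
  have c: "0 \<le> ?c" by (simp add: stop_range remaining_range)
  have "?c * ?g s \<le> max (?c * ?g r) (?c * ?g t)" "min (?c * ?g r) (?c * ?g t) \<le> ?c * ?g s"
    using mult_left_mono[OF gate_between(1)[OF assms(3,4), of "snd (snd (T n))"] c]
      mult_left_mono[OF gate_between(2)[OF assms(3,4), of "snd (snd (T n))"] c] c
    by (simp_all add: min_mult_distrib_left max_mult_distrib_left)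
  then show ?thesis using assms(1,2) unfolding step_ok_def by (auto simp: min_def max_def split: if_splits)
qed

lemma connected_Phi: "connected (\<Phi> i y)"
proof (rule connected_order_convex)
  fix a b x assume ab: "a \<in> \<Phi> i y" "b \<in> \<Phi> i y" "a \<le> x" "x \<le> b"
  show "x \<in> \<Phi> i y"
  proof (cases i)
    case (Free l)
    have "step_ok y x T n" if "Free l \<notin> F" "active T" "l = pref T n" for T n
      by (rule step_ok_order_convex[OF _ _ ab(3,4)]) (use ab(1,2) that Free in \<open>auto simp: \<Phi>_def\<close>)
    moreover have "Free l \<in> F \<longrightarrow> \<bar>x - u (Free l)\<bar> \<le> \<eta>" "x \<in> {0..1}"
      using ab Free by (auto simp: \<Phi>_def)
    ultimately show ?thesis unfolding \<Phi>_def Free by auto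
  next
    case (Task T)
    then show ?thesis using ab window_order_convex[of a T y b x] by (auto simp: \<Phi>_def)
  qed
qed

text \<open>Otherwise \<open>stop\<close> would reach 1 at \<open>u\<close>, all weight would be
  used up and \<open>Task T\<close> would be settled.\<close>

lemma active_base: 
  assumes "active T"
  shows "u (fst (T j)) = fst (snd (T j))"
proof (rule ccontr)
  assume "\<not> ?thesis"
  then obtain N where "stop T N u = 1" by (rule stop_eventually_one) blast
  then have "remaining T (Suc N) u = 0" by simp
  then show False using assms unfolding settled_def by blast
qed

lemma E_subset_Sol: "E \<subseteq> Sol"
  by (auto simp: E_def)

lemma E_close: "y \<in> E \<Longrightarrow> i \<in> F \<Longrightarrow> \<bar>y i - u i\<bar> \<le> \<tau>"
proof (cases "settled u i")
  case True
  assume "y \<in> E" "i \<in> F"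
  then show ?thesis using settled_close[OF _ True] by (auto simp: E_def)
next
  case False
  assume "y \<in> E" "i \<in> F"
  then have "\<bar>y i - u i\<bar> \<le> \<eta>" using False by (auto simp: E_def)
  then show ?thesis using eta by linarith
qed

text \<open>The value \<open>y (Task T)\<close> lies in the target and in every nested interval, so
  it witnesses feasibility after each step.\<close>

lemma E_solves:
  assumes y: "y \<in> E"
  shows "y i \<in> \<Phi> i y"
proof (cases i)
  case (Free l)
  have "step_ok y (y (Free l)) T n" if T: "active T" "l = pref T n" for T n
  proof -
    have "lo T \<le> y (Task T)" "y (Task T) \<le> hi T"
      using y T(1) by (auto simp: E_def abs_le_iff dest!: bspec[of _ _ "Task T"])
    moreover have "y (Task T) \<in> window T y" using y by (simp add: E_def Sol_def)
    then have "partial_sum T (Suc n) y \<le> y (Task T)" "y (Task T) \<le> partial_sum T (Suc n) y + remaining T (Suc n) y"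
      unfolding window_def by blast+
    ultimately show ?thesis using T(2) by (simp add: step_ok_def)
  qed
  then show ?thesis
    using y Sol_range[of y "Free l"] Free by (auto simp: \<Phi>_def E_def settled_def)
next
  case (Task T)
  have "y (Task T) \<in> window T y" using y by (simp add: E_def Sol_def)
  moreover have "lo T \<le> y (Task T)" "y (Task T) \<le> hi T" if "active T"
    using y that by (auto simp: E_def abs_le_iff dest!: bspec[of _ _ "Task T"])
  ultimately show ?thesis by (simp add: \<Phi>_def Task)
qed

text \<open>Induction along dependence. For an active \<open>T\<close> the target is feasible at
  stage 0, stays so at indices with free coordinate in \<open>F\<close> because they get no weight,
  and at the others by \<open>step_ok\<close>. Hence the window meets the target and the proviso in
  \<open>\<Phi>\<close> is satisfied.\<close>

lemma solves_E:
  assumes y: "\<And>i. y i \<in> \<Phi> i y"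
  shows "y \<in> E"
proof -
  have yS: "y \<in> Sol"
  proof -
    have "y (Free l) \<in> {0..1}" for l using y[of "Free l"] by (simp add: \<Phi>_def)
    moreover have "y (Task T) \<in> window T y" for T using y[of "Task T"] by (simp add: \<Phi>_def)
    ultimately show ?thesis by (simp add: Sol_def)
  qed
  have "i \<in> F \<longrightarrow> \<not> settled u i \<longrightarrow> \<bar>y i - u i\<bar> \<le> \<eta>" for i
    using wf_trancl[OF wf_dep]
  proof (induction i rule: wf_induct_rule)
    case (less i)
    show ?case
    proof (intro impI)
      assume i: "i \<in> F" "\<not> settled u i"
      show "\<bar>y i - u i\<bar> \<le> \<eta>"
      proof (cases i)
        case (Free l)
        then show ?thesis using y[of "Free l"] i by (simp add: \<Phi>_def)
      next
        case (Task T)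
        have act: "active T" using i Task by simp
        have close: "\<bar>y j - u j\<bar> \<le> \<tau>" if j: "j \<in> F" "(j, i) \<in> dep\<^sup>+" for j
        proof (cases "settled u j")
          case True
          show ?thesis
            by (rule settled_close[OF j(1) True yS]) (use less.IH j(2) trancl_trans in metis)
        next
          case False
          then have "\<bar>y j - u j\<bar> \<le> \<eta>" using less.IH j by blast
          then show ?thesis using eta by linarith
        qed
        \<comment> \<open>The deviations before \<open>k\<close> concern coordinates in
          \<open>F\<close> below \<open>Task T\<close>, each within \<open>\<tau>\<close> of its
          value at \<open>u\<close>, which is the prescribed real by
          \<open>active_base\<close>.\<close>
        have stop0: "stop T k y = 0" if k: "Free (pref T k) \<in> F" for k
        proof -
          have "\<bar>y (fst (T j)) - fst (snd (T j))\<bar> \<le> \<tau>" if "j < k" for j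
          proof -
            have "fst (T j) \<in> F" by (rule free_closed[OF k dep_Free_pref(1)[OF that]])
            moreover have "(fst (T j), i) \<in> dep\<^sup>+" unfolding Task using dep_Task(1) by blast
            ultimately show ?thesis using close[of "fst (T j)"] active_base[OF act, of j] by simp
          qed
          then have "(\<Sum>j<k. \<bar>y (fst (T j)) - fst (snd (T j))\<bar>) \<le> real k * \<tau>"
            using sum_bounded_above[of "{..<k}" "\<lambda>j. \<bar>y (fst (T j)) - fst (snd (T j))\<bar>" \<tau>] by simp
          then have "real k * (\<Sum>j<k. \<bar>y (fst (T j)) - fst (snd (T j))\<bar>) \<le> real k * (real k * \<tau>)"
            by (intro mult_left_mono) auto
          also have "\<dots> \<le> 1" using tau[OF k] by (simp add: pref_def)
          finally show ?thesis by (simp add: stop_def clamp01_def)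
        qed
        have init: "remaining T n y = 1 \<and> partial_sum T n y = 0" if "\<And>k. k < n \<Longrightarrow> Free (pref T k) \<in> F" for n
          using that by (induction n) (auto simp: stop0)
        have uT: "lo T \<le> 1" "0 \<le> hi T" using Sol_range[OF u, of "Task T"] eta by auto
        have feasible: "feasible (lo T) (hi T) T n y" for n
        proof (induction n)
          case 0
          show ?case using uT by (simp add: feasible_def)
        next
          case (Suc n)
          show ?case
          proof (cases "Free (pref T n) \<in> F")
            case True
            \<comment> \<open>Indices with free coordinate in \<open>F\<close> form an initial
              segment, so no weight has been spent through \<open>n\<close>.\<close>
            have "Free (pref T k) \<in> F" if "k < Suc n" for k
            proof (cases "k = n")
              case False
              then have "k < n" using that by simp
              then show ?thesis by (intro free_closed[OF True] dep_Free_pref(2))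
            qed (use True in simp)
            then show ?thesis using init[of "Suc n"] uT by (simp add: feasible_def del: remaining.simps partial_sum.simps)
          next
            case False
            then have "step_ok y (y (Free (pref T n))) T n"
              using y[of "Free (pref T n)"] act by (auto simp: \<Phi>_def)
            then show ?thesis using Suc by (simp add: step_ok_def feasible_def)
          qed
        qed
        have "\<exists>s\<in>window T y. lo T \<le> s \<and> s \<le> hi T"
          by (rule window_meets) (use feasible eta in \<open>auto simp: feasible_def\<close>)
        then have "lo T \<le> y i \<and> y i \<le> hi T" using y[of i] act by (auto simp: \<Phi>_def Task)
        then show ?thesis using Task by (simp add: abs_le_iff)
      qed
    qed
  qed
  then show ?thesis using yS by (simp add: E_def)
qed

lemma compact_E: "compact E"
proof -
  have "E = Sol \<inter> (\<Inter>i\<in>{i\<in>F. \<not> settled u i}. {y. \<bar>y i - u i\<bar> \<le> \<eta>})"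
    by (auto simp: E_def)
  moreover have "closed (\<Inter>i\<in>{i\<in>F. \<not> settled u i}. {y. \<bar>y i - u i\<bar> \<le> \<eta>})"
    by (intro closed_INT ballI closed_Collect_le continuous_intros continuous_on_product_coordinates)
  ultimately show ?thesis using compact_Sol by (simp add: compact_Int_closed)
qed

lemma connected_E: "connected E"
proof -
  have E: "E = {y. \<forall>i. y i \<in> \<Phi> i y}" using E_solves solves_E by blast
  show ?thesis unfolding E
    by (rule constraint_system_connected[OF wf_dep Phi_cong Phi_nonempty connected_Phi])
      (simp_all add: compact_E flip: E)
qed

lemma E_nbhd: "\<exists>U. open U \<and> u \<in> U \<and> U \<inter> Sol \<subseteq> E"
proof (intro exI conjI)
  let ?U = "\<Inter>i\<in>F. {y. \<bar>y i - u i\<bar> < \<eta>}"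
  show "open ?U"
    by (intro open_INT fin ballI open_Collect_less continuous_intros continuous_on_product_coordinates)
  show "u \<in> ?U" using eta by simp
  show "?U \<inter> Sol \<subseteq> E" by (force simp: E_def)
qed

end

section \<open>Choice of the finite set \<open>F\<close> and of the two radii\<close>

lemma ex_common_positive:
  fixes P :: "'a \<Rightarrow> real \<Rightarrow> bool"
  assumes "finite G" "\<And>i. i \<in> G \<Longrightarrow> \<exists>\<eta>>0. P i \<eta>"
    and mono: "\<And>i \<eta> \<eta>'. P i \<eta> \<Longrightarrow> \<eta>' \<le> \<eta> \<Longrightarrow> P i \<eta>'"
  shows "\<exists>\<eta>>0. \<forall>i\<in>G. P i \<eta>"
  using assms(1,2)
proof (induction G)
  case empty
  show ?case by (intro exI[of _ 1]) simp
next
  case (insert x G)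
  obtain \<eta>1 where "\<eta>1 > 0" "\<forall>i\<in>G. P i \<eta>1" using insert by blast
  moreover obtain \<eta>2 where "\<eta>2 > 0" "P x \<eta>2" using insert.prems by blast
  ultimately have "min \<eta>1 \<eta>2 > 0 \<and> (\<forall>i\<in>insert x G. P i (min \<eta>1 \<eta>2))"
    using mono[of _ \<eta>1 "min \<eta>1 \<eta>2"] mono[of _ \<eta>2 "min \<eta>1 \<eta>2"] by auto
  then show ?case by blast
qed

lemma partial_sum_remaining_modulus:
  assumes "0 < \<tau>"
  obtains \<sigma> where "0 < \<sigma>" "\<And>y. (\<And>j. j < n \<Longrightarrow> \<bar>y (fst (T j)) - u (fst (T j))\<bar> \<le> \<sigma>) \<Longrightarrow>
    (\<And>j. j < n \<Longrightarrow> \<bar>y (Free (pref T j)) - u (Free (pref T j))\<bar> \<le> \<sigma>) \<Longrightarrow>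
    \<bar>partial_sum T n y - partial_sum T n u\<bar> < \<tau> \<and> \<bar>remaining T n y - remaining T n u\<bar> < \<tau>"
proof -
  define G where "G = (\<lambda>j. fst (T j)) ` {..<n} \<union> (\<lambda>j. Free (pref T j)) ` {..<n}"
  define W where "W = {y. \<bar>partial_sum T n y - partial_sum T n u\<bar> < \<tau>} \<inter> {y. \<bar>remaining T n y - remaining T n u\<bar> < \<tau>}"
  have "open W" unfolding W_def
    by (intro open_Int open_Collect_less continuous_intros continuous_on_partial_sum continuous_on_remaining)
  moreover have "u \<in> W" using assms by (simp add: W_def)
  ultimately obtain F \<delta> where \<delta>: "finite F" "\<delta> > 0"
    "\<And>y. (\<And>i. i \<in> F \<Longrightarrow> \<bar>y i - u i\<bar> < \<delta>) \<Longrightarrow> y \<in> W"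
    by (rule open_fun_box) blast
  have "\<bar>partial_sum T n y - partial_sum T n u\<bar> < \<tau> \<and> \<bar>remaining T n y - remaining T n u\<bar> < \<tau>"
    if y: "\<And>j. j < n \<Longrightarrow> \<bar>y (fst (T j)) - u (fst (T j))\<bar> \<le> \<delta> / 2"
       "\<And>j. j < n \<Longrightarrow> \<bar>y (Free (pref T j)) - u (Free (pref T j))\<bar> \<le> \<delta> / 2" for y
  proof -
    \<comment> \<open>Resetting all other coordinates to \<open>u\<close> moves the point into the
      box without changing either function.\<close>
    define y' where "y' = (\<lambda>i. if i \<in> G then y i else u i)"
    have "\<bar>y' i - u i\<bar> < \<delta>" for i
    proof (cases "i \<in> G")
      case True
      then have "\<bar>y i - u i\<bar> \<le> \<delta> / 2" using y by (auto simp: G_def)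
      then show ?thesis using \<delta>(2) True by (simp add: y'_def)
    qed (simp add: y'_def \<delta>(2))
    then have "y' \<in> W" by (intro \<delta>(3))
    moreover have "partial_sum T n y' = partial_sum T n y" "remaining T n y' = remaining T n y"
      by (rule partial_sum_cong remaining_cong; simp add: y'_def G_def)+
    ultimately show ?thesis by (simp add: W_def)
  qed
  then show thesis using that[of "\<delta> / 2"] \<delta>(2) by simp
qed

text \<open>Where \<open>remaining\<close> vanishes at \<open>u\<close>, the coordinate is squeezed
  between two functions that are continuous in finitely many predecessors, all in \<open>F\<close>;
  induction on \<open>dep\<close> controls those.\<close>

lemma settled_modulus:
  assumes u: "u \<in> Sol"
    and free_closed: "\<And>l j. Free l \<in> F \<Longrightarrow> (j, Free l) \<in> dep \<Longrightarrow> j \<in> F"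
    and settled_closed: "\<And>T. Task T \<in> F \<Longrightarrow> settled u (Task T) \<Longrightarrow>
      \<exists>n. remaining T n u = 0 \<and> Free (pref T n) \<in> F"
    and "i \<in> F" "0 < \<tau>"
  shows "\<exists>\<eta>>0. \<forall>y\<in>Sol. (\<forall>j\<in>F. (j, i) \<in> dep\<^sup>* \<and> \<not> settled u j \<longrightarrow> \<bar>y j - u j\<bar> \<le> \<eta>) \<longrightarrow> \<bar>y i - u i\<bar> \<le> \<tau>"
  using wf_dep assms(4,5)
proof (induction i arbitrary: \<tau> rule: wf_induct_rule)
  case (less i)
  define P where "P i \<tau> \<eta> \<longleftrightarrow> (\<forall>y\<in>Sol. (\<forall>j\<in>F. (j, i) \<in> dep\<^sup>* \<and> \<not> settled u j \<longrightarrow> \<bar>y j - u j\<bar> \<le> \<eta>) \<longrightarrow> \<bar>y i - u i\<bar> \<le> \<tau>)" for i \<tau> \<eta>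
  have IH: "\<exists>\<eta>>0. P j \<sigma> \<eta>" if "(j, i) \<in> dep" "j \<in> F" "0 < \<sigma>" for j \<sigma>
    using less.IH[OF that] unfolding P_def .
  have "\<exists>\<eta>>0. P i \<tau> \<eta>"
  proof (cases "settled u i")
    case False
    then have "P i \<tau> \<tau>" unfolding P_def using less.prems by blast
    then show ?thesis using less.prems by blast
  next
    case True
    then obtain T where i: "i = Task T" by (auto simp: settled_def)
    obtain n where n: "remaining T n u = 0" "Free (pref T n) \<in> F"
      using settled_closed[of T] less.prems True i by blast
    define G where "G = (\<lambda>j. fst (T j)) ` {..<n} \<union> (\<lambda>j. Free (pref T j)) ` {..<n}"
    have "(g, Free (pref T n)) \<in> dep" if "g \<in> G" for g
      using that dep_Free_pref[of _ n T] by (auto simp: G_def)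
    then have GF: "G \<subseteq> F" using free_closed n(2) by blast
    have Gi: "(g, i) \<in> dep" if "g \<in> G" for g
      using that dep_Task[of T] by (auto simp: i G_def)
    have "0 < \<tau> / 2" using less.prems by simp
    then obtain \<sigma> where \<sigma>: "0 < \<sigma>" "\<And>y. (\<And>j. j < n \<Longrightarrow> \<bar>y (fst (T j)) - u (fst (T j))\<bar> \<le> \<sigma>) \<Longrightarrow>
      (\<And>j. j < n \<Longrightarrow> \<bar>y (Free (pref T j)) - u (Free (pref T j))\<bar> \<le> \<sigma>) \<Longrightarrow>
      \<bar>partial_sum T n y - partial_sum T n u\<bar> < \<tau> / 2 \<and> \<bar>remaining T n y - remaining T n u\<bar> < \<tau> / 2"
      by (rule partial_sum_remaining_modulus[where n = n and T = T and u = u]) blast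
    have "\<exists>\<eta>>0. \<forall>g\<in>G. P g \<sigma> \<eta>"
    proof (rule ex_common_positive)
      show "finite G" by (simp add: G_def)
      show "\<exists>\<eta>>0. P g \<sigma> \<eta>" if "g \<in> G" for g
        using IH[OF Gi[OF that] _ \<sigma>(1)] that GF by blast
      show "P g \<sigma> \<eta>'" if "P g \<sigma> \<eta>" "\<eta>' \<le> \<eta>" for g \<eta> \<eta>'
        using that unfolding P_def by (meson order_trans)
    qed
    then obtain \<eta> where \<eta>: "\<eta> > 0" "\<And>g. g \<in> G \<Longrightarrow> P g \<sigma> \<eta>" by blast
    have "P i \<tau> \<eta>" unfolding P_def
    proof (intro ballI impI)
      fix y assume y: "y \<in> Sol" and close: "\<forall>j\<in>F. (j, i) \<in> dep\<^sup>* \<and> \<not> settled u j \<longrightarrow> \<bar>y j - u j\<bar> \<le> \<eta>"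
      have "\<bar>y g - u g\<bar> \<le> \<sigma>" if "g \<in> G" for g
      proof -
        have "\<forall>j\<in>F. (j, g) \<in> dep\<^sup>* \<and> \<not> settled u j \<longrightarrow> \<bar>y j - u j\<bar> \<le> \<eta>"
          using close Gi[OF that] by (meson rtrancl.rtrancl_into_rtrancl)
        then show ?thesis using \<eta>(2)[OF that] y unfolding P_def by blast
      qed
      then have "\<bar>partial_sum T n y - partial_sum T n u\<bar> < \<tau> / 2 \<and> \<bar>remaining T n y - remaining T n u\<bar> < \<tau> / 2"
        by (intro \<sigma>(2)) (auto simp: G_def)
      moreover have "partial_sum T n y \<le> y i \<and> y i \<le> partial_sum T n y + remaining T n y"
        using y unfolding Sol_def window_def i by blast
      moreover have "u i = partial_sum T n u"
        using u window_remaining_zero[OF n(1), of "u i"] unfolding Sol_def i by blast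
      ultimately show "\<bar>y i - u i\<bar> \<le> \<tau>" using n(1) by linarith
    qed
    then show ?thesis using \<eta>(1) by blast
  qed
  then show ?case unfolding P_def .
qed

text \<open>The alternatives serve \<open>free_closed\<close>, \<open>settled_modulus\<close> and
  \<open>pair_closed\<close>. Demands of a single coordinate sit on the diagonal
  \<open>i = j\<close> to fit \<open>finite_closure_in_context\<close>. The first difference marks
  the longest common prefix; shorter ones are predecessors of it.\<close>

definition required :: "(idx \<Rightarrow> real) \<Rightarrow> idx \<Rightarrow> idx \<Rightarrow> idx set" where
  "required u i j =
     {k. (\<exists>l. i = Free l \<and> j = Free l \<and> (k, Free l) \<in> dep) \<or>
         (\<exists>T. i = Task T \<and> j = Task T \<and> settled u i \<and> k = Free (pref T (LEAST n. remaining T n u = 0))) \<or>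
         (\<exists>T T'. i = Task T \<and> j = Task T' \<and> T \<noteq> T' \<and> k = Free (pref T (LEAST n. T n \<noteq> T' n)))}"

lemma finite_required: "finite (required u i j)"
proof (cases i)
  case (Free l)
  have "required u i j \<subseteq> fst ` set l \<union> (\<lambda>k. Free (take k l)) ` {..<length l}"
    unfolding required_def Free by (auto simp: dep_def)
  then show ?thesis by (rule finite_subset) simp
next
  case (Task T)
  show ?thesis
  proof (cases j)
    case (Task T')
    have "required u i j \<subseteq> {Free (pref T (LEAST n. remaining T n u = 0)), Free (pref T (LEAST n. T n \<noteq> T' n))}"
      unfolding required_def Task \<open>i = Task T\<close> by auto
    then show ?thesis by (rule finite_subset) simp
  qed (simp add: required_def Task)
qed

lemma pref_first_difference:
  "pref T (LEAST n. T n \<noteq> T' n) = pref T' (LEAST n. T n \<noteq> T' n)"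
  unfolding pref_def using not_less_Least by fastforce

lemma required_sym: "required u i j = required u j i"
proof -
  have "required u i j \<subseteq> required u j i" for i j
  proof
    fix k assume "k \<in> required u i j"
    then consider (a) l where "i = Free l" "j = Free l" "(k, Free l) \<in> dep"
      | (b) T where "i = Task T" "j = Task T" "settled u i" "k = Free (pref T (LEAST n. remaining T n u = 0))"
      | (c) T T' where "i = Task T" "j = Task T'" "T \<noteq> T'" "k = Free (pref T (LEAST n. T n \<noteq> T' n))"
      unfolding required_def by blast
    then show "k \<in> required u j i"
    proof cases
      case c
      have "(\<lambda>n. T n \<noteq> T' n) = (\<lambda>n. T' n \<noteq> T n)" by auto
      then have "k = Free (pref T' (LEAST n. T' n \<noteq> T n))"
        using c(4) pref_first_difference[of T T'] by simp
      then show ?thesis using c(1-3) unfolding required_def by blast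
    qed (auto simp: required_def)
  qed
  then show ?thesis by blast
qed

lemma required_below: "k \<in> required u i j \<Longrightarrow> (k, i) \<in> dep"
  unfolding required_def using dep_Task(2) by blast

text \<open>The finitely many coordinates of a box inside \<open>W\<close> are closed up under
  \<open>required\<close> to give \<open>F\<close>; the set \<open>E\<close> of the resulting system
  is the neighbourhood.\<close>

lemma Sol_connected_nbhd:
  assumes u: "u \<in> Sol" and W: "open W" "u \<in> W"
  shows "\<exists>E U. connected E \<and> E \<subseteq> Sol \<inter> W \<and> open U \<and> u \<in> U \<and> U \<inter> Sol \<subseteq> E"
proof -
  obtain F0 \<delta> where \<delta>: "finite F0" "\<delta> > 0" "\<And>y. (\<And>i. i \<in> F0 \<Longrightarrow> \<bar>y i - u i\<bar> < \<delta>) \<Longrightarrow> y \<in> W"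
    using W by (rule open_fun_box) blast
  obtain F where F: "finite F" "F0 \<subseteq> F" "\<And>s t. s \<in> F \<Longrightarrow> t \<in> F \<Longrightarrow> required u s t \<subseteq> F"
  proof -
    have "\<exists>H. finite H \<and> F0 \<subseteq> H \<and> (\<forall>s\<in>H. \<forall>t\<in>{} \<union> H. required u s t \<subseteq> {} \<union> H)"
      by (rule finite_closure_in_context[OF wf_dep])
        (auto simp: finite_required \<delta>(1) intro: required_below equalityD1[OF required_sym, THEN subsetD])
    then obtain H where "finite H" "F0 \<subseteq> H" and H: "\<forall>s\<in>H. \<forall>t\<in>H. required u s t \<subseteq> H"
      unfolding Un_empty_left by (elim exE conjE)
    then show ?thesis by (intro that[of H]) (assumption, assumption, rule H[rule_format])
  qed
  have free_closed: "j \<in> F" if "Free l \<in> F" "(j, Free l) \<in> dep" for l j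
    by (rule subsetD[OF F(3)[OF that(1) that(1)]]) (use that(2) in \<open>simp add: required_def\<close>)
  have settled_closed: "\<exists>n. remaining T n u = 0 \<and> Free (pref T n) \<in> F"
    if T: "Task T \<in> F" "settled u (Task T)" for T
  proof (intro exI conjI)
    show "remaining T (LEAST n. remaining T n u = 0) u = 0"
      using T(2) unfolding settled_def by (auto intro: LeastI)
    show "Free (pref T (LEAST n. remaining T n u = 0)) \<in> F"
      by (rule subsetD[OF F(3)[OF T(1) T(1)]]) (use T(2) in \<open>simp add: required_def\<close>)
  qed
  have pair_closed: "Free (pref T n) \<in> F"
    if T: "Task T \<in> F" "Task T' \<in> F" "T \<noteq> T'" "pref T n = pref T' n" for T T' n
  proof -
    define m where "m = (LEAST n. T n \<noteq> T' n)"
    have m: "Free (pref T m) \<in> F"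
      by (rule subsetD[OF F(3)[OF T(1,2)]]) (use T(3) in \<open>simp add: required_def m_def\<close>)
    have "\<exists>n. T n \<noteq> T' n" using T(3) by (simp add: fun_eq_iff)
    then have diff: "T m \<noteq> T' m" unfolding m_def by (rule LeastI_ex)
    have "n \<le> m"
    proof (rule ccontr)
      assume "\<not> n \<le> m"
      then show False using arg_cong[OF T(4), of "\<lambda>l. l ! m"] diff by (simp add: pref_def)
    qed
    show ?thesis
    proof (cases "n = m")
      case False
      then have "n < m" using \<open>n \<le> m\<close> by simp
      then show ?thesis by (intro free_closed[OF m] dep_Free_pref(2))
    qed (use m in simp)
  qed
  \<comment> \<open>\<open>\<tau>\<close> is fixed before \<open>\<eta>\<close>, since
    \<open>settled_modulus\<close> produces the latter from the former.\<close>
  have "\<exists>\<tau>>0. \<forall>i\<in>F. \<tau> < \<delta> \<and> (\<forall>l. i = Free l \<longrightarrow> real (length l) * (real (length l) * \<tau>) \<le> 1)"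
  proof (rule ex_common_positive[OF F(1)])
    show "\<exists>\<tau>>0. \<tau> < \<delta> \<and> (\<forall>l. i = Free l \<longrightarrow> real (length l) * (real (length l) * \<tau>) \<le> 1)" for i
    proof (cases i)
      case (Free l)
      define N where "N = 1 + real (length l) * real (length l)"
      have "N > 0" "real (length l) * real (length l) \<le> N" by (simp_all add: N_def add_pos_nonneg)
      then have "real (length l) * (real (length l) * min (\<delta> / 2) (1 / N)) \<le> N * (1 / N)"
        unfolding mult.assoc[symmetric] using \<delta>(2) by (intro mult_mono) auto
      then show ?thesis using Free \<delta>(2) \<open>N > 0\<close> by (intro exI[of _ "min (\<delta> / 2) (1 / N)"]) auto
    next
      case (Task T)
      then show ?thesis using \<delta>(2) by (intro exI[of _ "\<delta> / 2"]) auto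
    qed
    show "\<eta>' < \<delta> \<and> (\<forall>l. i = Free l \<longrightarrow> real (length l) * (real (length l) * \<eta>') \<le> 1)"
      if "\<eta> < \<delta> \<and> (\<forall>l. i = Free l \<longrightarrow> real (length l) * (real (length l) * \<eta>) \<le> 1)" "\<eta>' \<le> \<eta>" for i \<eta> \<eta>'
    proof (intro conjI allI impI)
      fix l assume "i = Free l"
      then have "real (length l) * (real (length l) * \<eta>) \<le> 1" using that(1) by blast
      moreover have "real (length l) * (real (length l) * \<eta>') \<le> real (length l) * (real (length l) * \<eta>)"
        by (intro mult_left_mono that(2)) simp_all
      ultimately show "real (length l) * (real (length l) * \<eta>') \<le> 1" by linarith
    qed (use that in linarith)
  qed
  then obtain \<tau> where \<tau>: "\<tau> > 0" "\<And>i. i \<in> F \<Longrightarrow> \<tau> < \<delta>"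
    "\<And>l. Free l \<in> F \<Longrightarrow> real (length l) * (real (length l) * \<tau>) \<le> 1" by blast
  let ?P = "\<lambda>i \<eta>. \<eta> \<le> \<tau> \<and> (\<forall>y\<in>Sol. (\<forall>j\<in>F. (j, i) \<in> dep\<^sup>* \<and> \<not> settled u j \<longrightarrow> \<bar>y j - u j\<bar> \<le> \<eta>) \<longrightarrow> \<bar>y i - u i\<bar> \<le> \<tau>)"
  have mono: "?P i \<eta>'" if "?P i \<eta>" "\<eta>' \<le> \<eta>" for i \<eta> \<eta>'
    using that by (meson order_trans)
  have each: "\<exists>\<eta>>0. ?P i \<eta>" if i: "i \<in> F" for i
  proof -
    have "\<exists>\<eta>>0. \<forall>y\<in>Sol. (\<forall>j\<in>F. (j, i) \<in> dep\<^sup>* \<and> \<not> settled u j \<longrightarrow> \<bar>y j - u j\<bar> \<le> \<eta>) \<longrightarrow> \<bar>y i - u i\<bar> \<le> \<tau>"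
      by (rule settled_modulus[OF u _ _ i \<tau>(1)]) (erule (1) free_closed, erule (1) settled_closed)
    then obtain \<eta> where "\<eta> > 0" "\<forall>y\<in>Sol. (\<forall>j\<in>F. (j, i) \<in> dep\<^sup>* \<and> \<not> settled u j \<longrightarrow> \<bar>y j - u j\<bar> \<le> \<eta>) \<longrightarrow> \<bar>y i - u i\<bar> \<le> \<tau>"
      by blast
    then have "min \<eta> \<tau> > 0 \<and> ?P i (min \<eta> \<tau>)" using \<tau>(1) by auto
    then show ?thesis by blast
  qed
  have "\<exists>\<eta>>0. \<forall>i\<in>F. ?P i \<eta>"
    by (rule ex_common_positive[where P = ?P, OF F(1)]) (erule each, erule (1) mono)
  then obtain \<eta>0 where \<eta>0: "\<eta>0 > 0" "\<And>i. i \<in> F \<Longrightarrow> ?P i \<eta>0" by blast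
  define \<eta> where "\<eta> = min \<eta>0 \<tau>"
  have \<eta>: "\<eta> > 0" "\<eta> \<le> \<tau>" using \<eta>0(1) \<tau>(1) by (simp_all add: \<eta>_def)
  have P: "?P i \<eta>" if "i \<in> F" for i
    by (rule mono[OF \<eta>0(2)[OF that]]) (simp add: \<eta>_def)
  interpret nbhd_system F u \<eta> \<tau>
  proof
    show "\<bar>y i - u i\<bar> \<le> \<tau>"
      if i: "i \<in> F" "settled u i" "y \<in> Sol"
        "\<And>j. j \<in> F \<Longrightarrow> (j, i) \<in> dep\<^sup>+ \<Longrightarrow> \<not> settled u j \<Longrightarrow> \<bar>y j - u j\<bar> \<le> \<eta>" for i y
    proof -
      have "\<bar>y j - u j\<bar> \<le> \<eta>" if "j \<in> F" "(j, i) \<in> dep\<^sup>*" "\<not> settled u j" for j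
        using i(2,4) that by (metis rtranclD)
      then show ?thesis using P[OF i(1)] i(3) by blast
    qed
  qed (fact u F(1) \<eta> free_closed pair_closed \<tau>(3))+
  have "E \<subseteq> W"
  proof
    fix y assume y: "y \<in> E"
    show "y \<in> W"
    proof (rule \<delta>(3))
      fix i assume "i \<in> F0"
      then have i: "i \<in> F" using F(2) by blast
      show "\<bar>y i - u i\<bar> < \<delta>" using E_close[OF y i] \<tau>(2)[OF i] by linarith
    qed
  qed
  then show ?thesis using connected_E E_subset_Sol E_nbhd by blast
qed

lemma locally_connected_Sol: "locally_connected_space (top_of_set Sol)"
  unfolding locally_connected_space_def neighbourhood_base_of
proof (intro allI impI, elim conjE)
  fix V u assume V: "openin (top_of_set Sol) V" "u \<in> V"
  then obtain W where W: "open W" "V = Sol \<inter> W" by (auto simp: openin_open)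
  then obtain E U where E: "connected E" "E \<subseteq> Sol \<inter> W" "open U" "u \<in> U" "U \<inter> Sol \<subseteq> E"
    using Sol_connected_nbhd[of u W] V(2) by auto
  have "openin (top_of_set Sol) (Sol \<inter> U)" using E(3) by (auto simp: openin_open)
  moreover have "connectedin (top_of_set Sol) E"
    using E(1,2) by (simp add: connectedin_subtopology)
  moreover have "u \<in> Sol \<inter> U" "Sol \<inter> U \<subseteq> E" using V(2) W(2) E(4,5) by auto
  ultimately show "\<exists>U K. openin (top_of_set Sol) U \<and> connectedin (top_of_set Sol) K \<and> u \<in> U \<and> U \<subseteq> K \<and> K \<subseteq> V"
    using E(2) W(2) by blast
qed

section \<open>Convergent sequences\<close>

lemma Sol_not_tendsto:
  assumes y: "\<And>k. y k \<in> Sol" "\<And>k. y k \<noteq> l" and lim: "\<And>i. (\<lambda>k. y k i) \<longlonglongrightarrow> l i"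
  shows False
proof -
  have "\<exists>i. y k i \<noteq> l i" for k using y(2)[of k] by (auto simp: fun_eq_iff)
  then obtain D where D: "\<And>k. y k (D k) \<noteq> l (D k)" by metis
  \<comment> \<open>\<open>stop\<close> does not read the gates, so it can be studied with dummy
    gates before the real ones are chosen.\<close>
  define T0 where "T0 n = (D n, l (D n), False, False)" for n
  have one: "\<exists>N. \<forall>n\<ge>N. stop T0 n (y k) = 1" for k
    by (rule stop_eventually_one[of "y k" T0 k]) (use D[of k] in \<open>auto simp: T0_def\<close>)
  have zero: "eventually (\<lambda>k. stop T0 n (y k) = 0) sequentially" for n
  proof -
    have "(\<lambda>k. real n * (\<Sum>j<n. \<bar>y k (fst (T0 j)) - fst (snd (T0 j))\<bar>)) \<longlonglongrightarrow>
        real n * (\<Sum>j<n. \<bar>l (fst (T0 j)) - fst (snd (T0 j))\<bar>)"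
      by (intro tendsto_intros lim)
    then have "(\<lambda>k. real n * (\<Sum>j<n. \<bar>y k (fst (T0 j)) - fst (snd (T0 j))\<bar>)) \<longlonglongrightarrow> 0"
      by (simp add: T0_def)
    then have "eventually (\<lambda>k. real n * (\<Sum>j<n. \<bar>y k (fst (T0 j)) - fst (snd (T0 j))\<bar>) < 1) sequentially"
      by (rule order_tendstoD) simp
    then show ?thesis by eventually_elim (simp add: stop_def clamp01_def)
  qed
  have zeros: "eventually (\<lambda>k. \<forall>n\<le>N. stop T0 n (y k) = 0) sequentially" for N
    using zero by (simp add: eventually_ball_finite flip: Ball_def atMost_iff)
  \<comment> \<open>A pair \<open>s\<close> holds the number of a term and an index from which
    \<open>stop\<close> is 1 at that term; \<open>Q\<close> keeps \<open>stop\<close> at 0 for the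
    next term through that index, which separates the blocks.\<close>
  define P where "P s \<longleftrightarrow> (\<forall>n\<ge>snd s. stop T0 n (y (fst s)) = 1)" for s :: "nat \<times> nat"
  define Q where "Q s s' \<longleftrightarrow> fst s < fst s' \<and> snd s \<le> snd s' \<and> (\<forall>n\<le>snd s. stop T0 n (y (fst s')) = 0)"
    for s s' :: "nat \<times> nat"
  have "\<exists>s. \<forall>r. P (s r) \<and> Q (s r) (s (Suc r))"
  proof (rule dependent_nat_choice[where P = "\<lambda>_. P" and Q = "\<lambda>_. Q"])
    show "\<exists>s. P s" using one[of 0] unfolding P_def by (metis fst_conv snd_conv)
    show "\<exists>s'. P s' \<and> Q s s'" for s
    proof -
      obtain K where K: "\<And>k. k \<ge> K \<Longrightarrow> \<forall>n\<le>snd s. stop T0 n (y k) = 0"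
        using zeros[of "snd s"] by (auto simp: eventually_sequentially)
      define k where "k = max K (Suc (fst s))"
      obtain N where N: "\<And>n. n \<ge> N \<Longrightarrow> stop T0 n (y k) = 1" using one[of k] by blast
      have "P (k, max N (snd s)) \<and> Q s (k, max N (snd s))"
        using N K[of k] unfolding P_def Q_def by (auto simp: k_def)
      then show ?thesis by blast
    qed
  qed
  then obtain s where s: "\<And>r. P (s r)" "\<And>r. Q (s r) (s (Suc r))" by blast
  define kk where "kk r = fst (s r)" for r
  define NN where "NN r = snd (s r)" for r
  have kk: "strict_mono kk" using s(2) by (simp add: strict_mono_Suc_iff kk_def Q_def)
  have NN: "incseq NN" using s(2) by (simp add: incseq_SucI NN_def Q_def)
  have stop1: "stop T0 (NN r) (y (kk r)) = 1" for r
    using s(1)[of r] by (simp add: P_def NN_def kk_def)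
  have stop0: "stop T0 n (y (kk (Suc r))) = 0" if "n \<le> NN r" for n r
    using s(2)[of r] that by (simp add: Q_def NN_def kk_def)
  \<comment> \<open>The number of the block containing \<open>n\<close>; only the term with this
    number can give weight to \<open>n\<close>.\<close>
  define \<rho> where "\<rho> n = (LEAST r. n \<le> NN r)" for n
  define entry where "entry n L = (D n, l (D n), tuned (odd (\<rho> n)) (y (kk (\<rho> n)) (Free L)))" for n L
  \<comment> \<open>The gate of entry \<open>n\<close> is tuned to the free coordinate named by the
    list of earlier entries, so the list itself is what the recursion builds.\<close>
  define L where "L = rec_nat [] (\<lambda>n L. L @ [entry n L])"
  define T where "T n = entry n (L n)" for n
  have pref: "pref T n = L n" for n
    by (induction n) (simp_all add: pref_def L_def T_def)
  have stopT: "stop T n z = stop T0 n z" for n z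
    by (simp add: stop_def T_def T0_def entry_def)
  have val: "y (kk r) (Task T) = (if odd r then 1 else 0)" for r
  proof -
    let ?Y = "y (kk r)" and ?v = "if odd r then 1 else 0 :: real"
    have rem0: "remaining T (Suc (NN r)) ?Y = 0" using stop1[of r] by (simp add: stopT)
    \<comment> \<open>Wherever this term has weight the gate takes the value \<open>?v\<close>, so
      the sum is \<open>?v\<close> times the mass given out.\<close>
    have partial_sum: "partial_sum T n ?Y = ?v * (1 - remaining T n ?Y)" for n
    proof (induction n)
      case (Suc n)
      show ?case
      proof (cases "stop T n ?Y = 0 \<or> remaining T n ?Y = 0")
        case True
        then show ?thesis using Suc by auto
      next
        case False
        have "n \<le> NN r" using remaining_zero_mono[OF rem0, of n] False by linarith
        moreover have "\<not> n \<le> NN r'" if r': "r' < r" for r'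
        proof -
          obtain r0 where r0: "r = Suc r0" "r' \<le> r0" using r' by (cases r) auto
          have "\<not> n \<le> NN r0" using stop0[of n r0] False r0(1) by (auto simp: stopT)
          then show ?thesis using incseqD[OF NN r0(2)] by linarith
        qed
        ultimately have "\<rho> n = r" unfolding \<rho>_def by (intro Least_equality) (auto simp: not_less[symmetric])
        then have "gate (snd (snd (T n))) (?Y (Free (pref T n))) = ?v"
          by (simp add: T_def entry_def pref gate_tuned)
        then show ?thesis using Suc by (simp add: algebra_simps)
      qed
    qed simp
    have "?Y (Task T) = partial_sum T (Suc (NN r)) ?Y"
      using window_remaining_zero[OF rem0, of "?Y (Task T)"] y(1)[of "kk r"] unfolding Sol_def by blast
    then show ?thesis using partial_sum[of "Suc (NN r)"] rem0 by simp
  qed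
  have lim2: "(\<lambda>r. y (kk r) (Task T)) \<longlonglongrightarrow> l (Task T)"
    using LIMSEQ_subseq_LIMSEQ[OF lim[of "Task T"] kk] by (simp add: o_def)
  have "(\<lambda>r. y (kk (2 * r)) (Task T)) \<longlonglongrightarrow> l (Task T)"
    using LIMSEQ_subseq_LIMSEQ[OF lim2, of "\<lambda>r. 2 * r"] by (simp add: o_def strict_mono_def)
  moreover have "(\<lambda>r. y (kk (2 * r + 1)) (Task T)) \<longlonglongrightarrow> l (Task T)"
    using LIMSEQ_subseq_LIMSEQ[OF lim2, of "\<lambda>r. 2 * r + 1"] by (simp add: o_def strict_mono_def)
  ultimately have "l (Task T) = 0" "l (Task T) = 1"
    by (simp_all add: val LIMSEQ_const_iff)
  then show False by simp
qed

section \<open>Indexing by the reals\<close>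

text \<open>Coordinates are read as well-founded trees. The \<open>Suc\<close> reserves 0 for
  \<open>Task\<close>, so one number records the constructor and, for lists, the number of
  children.\<close>

fun kind :: "idx \<Rightarrow> nat" where
  "kind (Free l) = Suc (length l)"
| "kind (Task T) = 0"

fun child :: "idx \<Rightarrow> nat \<Rightarrow> idx \<times> real \<times> bool \<times> bool" where
  "child (Free l) j = (if j < length l then l ! j else (Free [], 0, False, False))"
| "child (Task T) j = T j"

primrec label_at :: "nat list \<Rightarrow> idx \<times> real \<times> bool \<times> bool \<Rightarrow> nat \<times> real \<times> bool \<times> bool" where
  "label_at [] e = (kind (fst e), snd e)"
| "label_at (j # p) e = label_at p (child (fst e) j)"

text \<open>The empty path compares the roots; paths through the \<open>j\<close>-th child reduce to
  the induction hypothesis.\<close>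

lemma label_at_inj: "(\<And>p. label_at p (i, a) = label_at p (i', a')) \<Longrightarrow> i = i' \<and> a = a'"
proof (induction i arbitrary: a i' a')
  case (Free l)
  have root: "Suc (length l) = kind i'" "a = a'" using Free.prems[of "[]"] by auto
  then obtain l' where i': "i' = Free l'" "length l = length l'" by (cases i') auto
  have "l ! j = l' ! j" if j: "j < length l" for j
  proof -
    have "label_at p (fst (l ! j), snd (l ! j)) = label_at p (fst (l' ! j), snd (l' ! j))" for p
      using Free.prems[of "j # p"] j i' by simp
    from Free.IH[OF nth_mem[OF j] fsts_fst this] show ?thesis by (simp add: prod_eq_iff)
  qed
  then have "l = l'" using i'(2) by (intro nth_equalityI)
  then show ?case using root i' by simp
next
  case (Task T)
  have root: "0 = kind i'" "a = a'" using Task.prems[of "[]"] by auto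
  then obtain T' where i': "i' = Task T'" by (cases i') auto
  have "T j = T' j" for j
  proof -
    have "label_at p (fst (T j), snd (T j)) = label_at p (fst (T' j), snd (T' j))" for p
      using Task.prems[of "j # p"] i' by simp
    from Task.IH[OF rangeI fsts_fst this] show ?thesis by (simp add: prod_eq_iff)
  qed
  then show ?case using root i' by auto
qed

text \<open>A coordinate is determined by its labels along the countably many finite paths, and such
  a family of labels can be coded as one set of natural numbers.\<close>

lemma ex_inj_idx_real: "\<exists>e :: idx \<Rightarrow> real. inj e"
proof -
  obtain g :: "nat set \<Rightarrow> real" where g: "inj g"
    using nat_sets_eqpoll_reals by (auto simp: eqpoll_def bij_betw_def)
  obtain f :: "real \<Rightarrow> nat set" where f: "inj f"
    using eqpoll_sym[OF nat_sets_eqpoll_reals] by (auto simp: eqpoll_def bij_betw_def)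
  \<comment> \<open>The tags 0 and 1 keep the discrete part of a label apart from its real
    number.\<close>
  define enc where "enc c = (case c of (n, x, b) \<Rightarrow>
      insert (to_nat (0 :: nat, to_nat (n, b))) ((\<lambda>k. to_nat (1 :: nat, k)) ` f x))"
    for c :: "nat \<times> real \<times> bool \<times> bool"
  have enc: "c = c'" if "enc c = enc c'" for c c'
  proof -
    obtain n x b where c: "c = (n, x, b)" by (cases c) auto
    obtain n' x' b' where c': "c' = (n', x', b')" by (cases c') auto
    have mem0: "to_nat (0 :: nat, m) \<in> enc (n, x, b) \<longleftrightarrow> m = to_nat (n, b)" for m n x and b :: "bool \<times> bool"
      by (auto simp: enc_def)
    have mem1: "to_nat (1 :: nat, m) \<in> enc (n, x, b) \<longleftrightarrow> m \<in> f x" for m n x and b :: "bool \<times> bool"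
      by (auto simp: enc_def)
    have "to_nat (n, b) = to_nat (n', b')" using mem0[of _ n x b] mem0[of _ n' x' b'] that c c' by auto
    moreover have "f x = f x'" using mem1[of _ n x b] mem1[of _ n' x' b'] that c c' by auto
    ultimately show ?thesis using c c' injD[OF f] by simp
  qed
  define e where "e i = g {to_nat (p, m) |p m. m \<in> enc (label_at p (i, 0, False, False))}" for i
  have "inj e"
  proof
    fix i i' assume "e i = e i'"
    then have eq: "{to_nat (p, m) |p m. m \<in> enc (label_at p (i, 0, False, False))} =
        {to_nat (p, m) |p m. m \<in> enc (label_at p (i', 0, False, False))}"
      unfolding e_def by (rule injD[OF g])
    have mem: "to_nat (p, m) \<in> {to_nat (p, m) |p m. m \<in> enc (label_at p (i, 0, False, False))} \<longleftrightarrow>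
        m \<in> enc (label_at p (i, 0, False, False))" for p m i
      by auto
    have "enc (label_at p (i, 0, False, False)) = enc (label_at p (i', 0, False, False))" for p
      using mem[of p _ i] mem[of p _ i'] eq by auto
    then show "i = i'" using label_at_inj[of i "(0, False, False)" i' "(0, False, False)"] enc by blast
  qed
  then show ?thesis by blast
qed

theorem mainTheorem1:
  assumes "Continuum_Hypothesis"
  shows "\<exists>X :: (real \<Rightarrow> real) topology.
           continuum_space X \<and> nondegenerate_space X \<and> locally_connected_space X \<and>
           \<not> (\<exists>x. nontrivial_convergent_sequence X x)"
proof -
  obtain e :: "idx \<Rightarrow> real" where e: "inj e" using ex_inj_idx_real by blast
  \<comment> \<open>\<open>h\<close> copies coordinates along \<open>e\<close>, with an arbitrary
    coordinate at reals outside the range of \<open>e\<close>; \<open>k\<close> reads them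
    back.\<close>
  define h where "h y = (\<lambda>r. y (inv e r))" for y :: "idx \<Rightarrow> real"
  define k where "k z = (\<lambda>i. z (e i))" for z :: "real \<Rightarrow> real"
  have kh: "k (h y) = y" for y using e by (simp add: k_def h_def)
  have cont_h: "continuous_on S h" for S
    unfolding h_def by (intro continuous_on_coordinatewise_then_product continuous_on_subset[OF continuous_on_product_coordinates subset_UNIV])
  have cont_k: "continuous_on S k" for S
    unfolding k_def by (intro continuous_on_coordinatewise_then_product continuous_on_subset[OF continuous_on_product_coordinates subset_UNIV])
  define X where "X = top_of_set (h ` Sol)"
  have "homeomorphic_maps (top_of_set Sol) X h k"
    unfolding homeomorphic_maps_def X_def
    using cont_h cont_k kh by (auto simp: continuous_map_in_subtopology)
  then have homeo: "top_of_set Sol homeomorphic_space X"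
    unfolding homeomorphic_space_def by blast
  have "Hausdorff_space (product_topology (\<lambda>i::real. euclidean::real topology) UNIV)"
    by (simp add: Hausdorff_space_product_topology)
  then have "Hausdorff_space X"
    by (simp add: X_def euclidean_product_topology Hausdorff_space_subtopology)
  moreover have "compact_space X"
    using homeomorphic_compact_space[OF homeo] compact_Sol by (simp add: compact_space_subtopology)
  moreover have "connected_space X"
    using homeomorphic_connected_space[OF homeo] connected_Sol by (simp add: connected_space_subtopology)
  moreover have "locally_connected_space X"
    using homeomorphic_locally_connected_space[OF homeo] locally_connected_Sol by simp
  moreover have "nondegenerate_space X"
  proof -
    obtain y0 where y0: "y0 \<in> Sol" "y0 (Free []) = 0"
      by (rule Sol_prescribed_Free_Nil[of 0]) simp_all
    obtain y1 where y1: "y1 \<in> Sol" "y1 (Free []) = 1"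
      by (rule Sol_prescribed_Free_Nil[of 1]) simp_all
    have "h y0 \<noteq> h y1"
    proof
      assume "h y0 = h y1"
      then have "k (h y0) = k (h y1)" by (rule arg_cong)
      then have "y0 = y1" unfolding kh .
      then show False using y0(2) y1(2) by simp
    qed
    then show ?thesis using y0(1) y1(1) unfolding nondegenerate_space_def X_def
      by (intro bexI[of _ "h y0"] bexI[of _ "h y1"]) simp_all
  qed
  moreover have "\<not> nontrivial_convergent_sequence X x" for x
  proof
    assume x: "nontrivial_convergent_sequence X x"
    then obtain l where l: "limitin X x l sequentially" and inj: "inj x" and ran: "range x \<subseteq> h ` Sol"
      by (auto simp: nontrivial_convergent_sequence_def X_def)
    have lim: "x \<longlonglongrightarrow> l" using l by (simp add: X_def limitin_subtopology)
    \<comment> \<open>An injective sequence hits its limit at most once; a tail avoids it, as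
      \<open>Sol_not_tendsto\<close> requires.\<close>
    have "\<exists>m. \<forall>n\<ge>m. x n \<noteq> l"
    proof (cases "\<exists>n. x n = l")
      case True
      then obtain n0 where n0: "x n0 = l" by blast
      have "x n \<noteq> l" if "n \<ge> Suc n0" for n using injD[OF inj, of n n0] that n0 by auto
      then show ?thesis by blast
    qed blast
    then obtain m where m: "\<And>n. n \<ge> m \<Longrightarrow> x n \<noteq> l" by blast
    have "l \<in> h ` Sol" using l by (simp add: X_def limitin_subtopology)
    then have hkl: "h (k l) = l" using kh by auto
    have hkx: "h (k (x n)) = x n" "k (x n) \<in> Sol" for n
    proof -
      obtain y where "y \<in> Sol" "x n = h y" using ran by blast
      then show "h (k (x n)) = x n" "k (x n) \<in> Sol" by (simp_all add: kh)
    qed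
    show False
    proof (rule Sol_not_tendsto)
      show "k (x (n + m)) \<in> Sol" for n by (rule hkx)
      show "k (x (n + m)) \<noteq> k l" for n
      proof
        assume "k (x (n + m)) = k l"
        then have "h (k (x (n + m))) = h (k l)" by (rule arg_cong)
        then have "x (n + m) = l" unfolding hkl hkx(1) .
        then show False using m[of "n + m"] by simp
      qed
      have "continuous_on UNIV (\<lambda>z :: real \<Rightarrow> real. z (e i))" for i by simp
      then have "(\<lambda>n. x n (e i)) \<longlonglongrightarrow> l (e i)" for i
        using lim continuous_on_tendsto_compose[of UNIV "\<lambda>z. z (e i)" x l] by simp
      then show "(\<lambda>n. k (x (n + m)) i) \<longlonglongrightarrow> k l i" for i
        unfolding k_def by (rule LIMSEQ_ignore_initial_segment)
    qed
  qed
  ultimately show ?thesis unfolding continuum_space_def by blast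
qed

end
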